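(* Let $\Delta$ be a $2$-dimensional PS ear-decomposable simplicial complex. Then its $h$-vector $h(\Delta) = (h_0(\Delta),h_1(\Delta),h_2(\Delta),h_3(\Delta))$ is a pure $\mathcal{O}$-sequence.
   Context: All simplicial complexes are finite abstract simplicial complexes. $\Delta$ is pure if all its facets have the same dimension. For a $2$-dimensional complex $\Delta$, let $f_i(\Delta)$ be the number of $i$-dimensional faces. Its $h$-vector is given by $h_0 = 1$, $h_1 = f_0-3$, $h_2 = f_1-2f_0+3$, $h_3 = f_2-f_1+f_0-1$. Let $\sigma^k$ be the $k$-dimensional simplex (all subsets of a $(k+1)$-element set) and $\partial\sigma^k$ its boundary complex (all proper subsets), with $\partial\sigma^0=\{\emptyset\}$; $*$ denotes the join on disjoint vertex sets. A PS sphere is a complex that is a join of simplex boundaries; a PS ball is a complex that is the join of a simplex and a PS sphere (the PS sphere may be $\{\emptyset\}$). In dimension 2 the PS spheres are $\partial\sigma^3$, $\partial\sigma^1*\partial\sigma^2$, $\partial\sigma^1*\partial\sigma^1*\partial\sigma^1$, and the PS balls are $\sigma^0*\partial\sigma^2$, $\sigma^0*\partial\sigma^1*\partial\sigma^1$, $\sigma^1*\partial\sigma^1$, $\sigma^2$. The boundary $\partial\Sigma$ of a PS ball $\Sigma$ is its boundary as a triangulated ball; for $\Sigma=\sigma^k*S$ it is $\partial\sigma^k*S$. A PS ear-decomposition of a pure $2$-dimensional complex $\Delta$ is a decomposition into subcomplexes $\Delta=\Sigma_0\cup\Sigma_1\cup\cdots\cup\Sigma_t$ such that (1) $\Sigma_0$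 is a PS $2$-sphere; (2) $\Sigma_j$ is a PS $2$-ball for $1\le j\le t$; (3) $\Sigma_j\cap\left(\bigcup_{i=0}^{j-1}\Sigma_i\right)=\partial\Sigma_j$ for $1\le j\le t$. $\Delta$ is PS ear-decomposable if it admits such a decomposition. A multicomplex is a finite collection of monomials closed under taking divisors; it is pure if all its maximal monomials under divisibility have the same degree (each variable has degree 1). If $d$ is the maximal degree of a monomial in the multicomplex $\mathcal{M}$, its $F$-vector is $F(\mathcal{M})=(F_0,\ldots,F_d)$, with $F_i$ the number of monomials of degree $i$ in $\mathcal{M}$. A pure $\mathcal{O}$-sequence is a vector that is the $F$-vector of some pure multicomplex. *)

theory Defs
  imports "HOL-Library.Multiset"
begin

section \<open>Finite abstract simplicial complexes\<close>

definition asc :: "'a set set \<Rightarrow> bool" where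
  "asc K \<longleftrightarrow> finite K \<and> {} \<in> K \<and> (\<forall>F\<in>K. finite F) \<and> (\<forall>F\<in>K. \<forall>G. G \<subseteq> F \<longrightarrow> G \<in> K)"

text \<open>Dimensions are integers, since the empty face and the complex \<open>{{}}\<close> have dimension \<open>-1\<close>.\<close>

definition face_dim :: "'a set \<Rightarrow> int" where
  "face_dim F = int (card F) - 1"

definition asc_dim :: "'a set set \<Rightarrow> int" where
  "asc_dim K = Max (face_dim ` K)"

definition facets :: "'a set set \<Rightarrow> 'a set set" where
  "facets K = {F \<in> K. \<forall>G\<in>K. F \<subseteq> G \<longrightarrow> G = F}"

definition pure_asc :: "'a set set \<Rightarrow> bool" where
  "pure_asc K \<longleftrightarrow> asc K \<and> (\<forall>F\<in>facets K. \<forall>G\<in>facets K. face_dim F = face_dim G)"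

definition f_num :: "'a set set \<Rightarrow> int \<Rightarrow> nat" where
  "f_num K i = card {F \<in> K. face_dim F = i}"

text \<open>The \<open>h\<close>-vector \<open>(h\<^sub>0, h\<^sub>1, h\<^sub>2, h\<^sub>3)\<close> of a complex of dimension 2 (and only for such complexes).\<close>

definition h_vector2 :: "'a set set \<Rightarrow> int list" where
  "h_vector2 K =
     [1,
      int (f_num K 0) - 3,
      int (f_num K 1) - 2 * int (f_num K 0) + 3,
      int (f_num K 2) - int (f_num K 1) + int (f_num K 0) - 1]"


section \<open>PS spheres and PS balls\<close>

text \<open>The simplex on a vertex set \<open>V\<close> with \<open>k + 1\<close> elements is \<open>Pow V\<close>; uses of the following two
  notions require \<open>V\<close> to be finite and nonempty.\<close>

definition simplex_bd :: "'a set \<Rightarrow> 'a set set" where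
  "simplex_bd V = Pow V - {V}"

text \<open>Meant for complexes on disjoint vertex sets; disjointness is required wherever it is used.\<close>

definition asc_join :: "'a set set \<Rightarrow> 'a set set \<Rightarrow> 'a set set" where
  "asc_join K L = {F \<union> G | F G. F \<in> K \<and> G \<in> L}"

text \<open>The rule \<open>empty\<close> is the join of no simplex boundaries, which is also the boundary of a
  0-simplex.\<close>

inductive ps_sphere :: "'a set set \<Rightarrow> bool" where
  empty: "ps_sphere {{}}"
| join: "finite V \<Longrightarrow> V \<noteq> {} \<Longrightarrow> ps_sphere S \<Longrightarrow> V \<inter> \<Union>S = {}
    \<Longrightarrow> ps_sphere (asc_join (simplex_bd V) S)"

definition ps_ball :: "'a set set \<Rightarrow> bool" where
  "ps_ball B \<longleftrightarrow>
     (\<exists>V S. finite V \<and> V \<noteq> {} \<and> ps_sphere S \<and> V \<inter> \<Union>S = {} \<and> B = asc_join (Pow V) S)"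

text \<open>The boundary of a triangulated ball is the subcomplex generated by the faces of codimension
  one that lie in exactly one facet. For PS balls this is computed in \<open>ball_bd_ps_ball\<close> below.\<close>

definition ball_bd :: "'a set set \<Rightarrow> 'a set set" where
  "ball_bd B =
     {F. \<exists>G\<in>B. F \<subseteq> G \<and> face_dim G = asc_dim B - 1 \<and> (\<exists>!H. H \<in> facets B \<and> G \<subseteq> H)}"


section \<open>PS ear-decompositions in dimension 2\<close>

definition ps_ear_decomposition :: "'a set set \<Rightarrow> nat \<Rightarrow> (nat \<Rightarrow> 'a set set) \<Rightarrow> bool" where
  "ps_ear_decomposition K t \<Sigma> \<longleftrightarrow>
     K = (\<Union>j\<le>t. \<Sigma> j) \<and>
     ps_sphere (\<Sigma> 0) \<and> asc_dim (\<Sigma> 0) = 2 \<and>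
     (\<forall>j\<in>{1..t}. ps_ball (\<Sigma> j) \<and> asc_dim (\<Sigma> j) = 2) \<and>
     (\<forall>j\<in>{1..t}. \<Sigma> j \<inter> (\<Union>i<j. \<Sigma> i) = ball_bd (\<Sigma> j))"

definition ps_ear_decomposable :: "'a set set \<Rightarrow> bool" where
  "ps_ear_decomposable K \<longleftrightarrow>
     pure_asc K \<and> asc_dim K = 2 \<and> (\<exists>t \<Sigma>. ps_ear_decomposition K t \<Sigma>)"


section \<open>Pure O-sequences\<close>

text \<open>A monomial in the variables \<open>x\<^sub>0, x\<^sub>1, \<dots>\<close> is the multiset of its variables (by index), so that
  \<open>\<subseteq>#\<close> is divisibility and \<open>size\<close> is the degree. As multicomplexes are finite, countably many
  variables suffice. Multicomplexes are nonempty, since otherwise there is no maximal degree.\<close>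

type_synonym monomial = "nat multiset"

definition multicomplex :: "monomial set \<Rightarrow> bool" where
  "multicomplex M \<longleftrightarrow> finite M \<and> M \<noteq> {} \<and> (\<forall>m\<in>M. \<forall>m'. m' \<subseteq># m \<longrightarrow> m' \<in> M)"

definition maximal_monomials :: "monomial set \<Rightarrow> monomial set" where
  "maximal_monomials M = {m \<in> M. \<forall>m'\<in>M. m \<subseteq># m' \<longrightarrow> m' = m}"

definition pure_multicomplex :: "monomial set \<Rightarrow> bool" where
  "pure_multicomplex M \<longleftrightarrow>
     multicomplex M \<and> (\<forall>m\<in>maximal_monomials M. \<forall>m'\<in>maximal_monomials M. size m = size m')"

definition F_vector :: "monomial set \<Rightarrow> nat list" where
  "F_vector M = map (\<lambda>i. card {m \<in> M. size m = i}) [0..<Suc (Max (size ` M))]"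

text \<open>Integer entries, because \<open>h\<close>-numbers are a priori integers.\<close>

definition pure_O_sequence :: "int list \<Rightarrow> bool" where
  "pure_O_sequence v \<longleftrightarrow> (\<exists>M. pure_multicomplex M \<and> v = map int (F_vector M))"


section \<open>The boundary of a PS ball\<close>

lemma ps_sphere_structure:
  assumes "ps_sphere S"
  shows "asc S \<and> (\<exists>n. (\<forall>F\<in>S. card F \<le> n \<and> (\<exists>H\<in>S. F \<subseteq> H \<and> card H = n)) \<and>
    (\<forall>G\<in>S. Suc (card G) = n \<longrightarrow>
       (\<exists>H\<in>S. \<exists>H'\<in>S. H \<noteq> H' \<and> G \<subseteq> H \<and> G \<subseteq> H' \<and> card H = n \<and> card H' = n)))"
  using assms
proof induction
  case empty
  show ?case by (auto simp: asc_def)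
next
  case (join V S)
  let ?J = "asc_join (simplex_bd V) S"
  obtain n where S: "asc S"
    and n: "\<forall>F\<in>S. card F \<le> n \<and> (\<exists>H\<in>S. F \<subseteq> H \<and> card H = n)"
      "\<forall>G\<in>S. Suc (card G) = n \<longrightarrow>
         (\<exists>H\<in>S. \<exists>H'\<in>S. H \<noteq> H' \<and> G \<subseteq> H \<and> G \<subseteq> H' \<and> card H = n \<and> card H' = n)"
    using join.IH by (elim conjE exE) (rule that)
  have le: "\<And>F. F \<in> S \<Longrightarrow> card F \<le> n"
    and ex: "\<And>F. F \<in> S \<Longrightarrow> \<exists>H\<in>S. F \<subseteq> H \<and> card H = n"
    using n(1) by simp_all
  note two = n(2)[rule_format]
  have finS: "finite S" "{} \<in> S" "\<And>F. F \<in> S \<Longrightarrow> finite F" "\<And>F G. F \<in> S \<Longrightarrow> G \<subseteq> F \<Longrightarrow> G \<in> S"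
    using S by (auto simp: asc_def)
  have cardU: "card (A \<union> B) = card A + card B" if "A \<subseteq> V" "B \<in> S" for A B
    using that join.hyps finS(3)[of B] by (intro card_Un_disjoint) (auto intro: finite_subset)
  have inJ: "A \<union> B \<in> ?J" if "A \<subset> V" "B \<in> S" for A B
    using that by (auto simp: asc_join_def simplex_bd_def)
  have JE: thesis
    if "F \<in> ?J" "\<And>A B. F = A \<union> B \<Longrightarrow> A \<subset> V \<Longrightarrow> B \<in> S \<Longrightarrow> thesis" for F thesis
    using that(1) by (auto simp: asc_join_def simplex_bd_def intro: that(2))
  define m where "m = card V - 1"
  have m: "card V = Suc m" using join.hyps by (simp add: m_def card_gt_0_iff)
  have Vle: "card A \<le> m" if "A \<subset> V" for A
    using psubset_card_mono[OF join.hyps(1) that] m by simp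
  have cm: "card (V - {v}) = m" if "v \<in> V" for v using that m by simp
  have ascJ: "asc ?J"
    unfolding asc_def
  proof (intro conjI ballI allI impI)
    have "?J = (\<lambda>(A, B). A \<union> B) ` (simplex_bd V \<times> S)" by (auto simp: asc_join_def)
    then show "finite ?J" using join.hyps finS(1) by (simp add: simplex_bd_def)
    show "{} \<in> ?J" using inJ[of "{}" "{}"] join.hyps finS by auto
  next
    fix F assume "F \<in> ?J"
    then obtain A B where F: "F = A \<union> B" "A \<subset> V" "B \<in> S" by (rule JE)
    then show "finite F" using finite_subset[of A V] join.hyps(1) finS(3)[of B] by auto
    fix G assume "G \<subseteq> F"
    then have eq: "(G \<inter> A) \<union> (G \<inter> B) = G" using F by blast
    have "G \<inter> A \<subset> V" using F by blast
    moreover have "G \<inter> B \<in> S" using F finS(4)[of B "G \<inter> B"] by simp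
    ultimately have "(G \<inter> A) \<union> (G \<inter> B) \<in> ?J" by (rule inJ)
    then show "G \<in> ?J" by (simp only: eq)
  qed
  show ?case
  proof (intro conjI exI[of _ "m + n"] ballI impI)
    show "asc ?J" by (rule ascJ)
  next
    fix F assume "F \<in> ?J"
    then obtain A B where F: "F = A \<union> B" "A \<subset> V" "B \<in> S" by (rule JE)
    show "card F \<le> m + n" using F cardU[of A B] Vle[of A] le[of B] by auto
    obtain H where H: "H \<in> S" "B \<subseteq> H" "card H = n" using ex F by blast
    obtain v where v: "v \<in> V" "v \<notin> A" using F by auto
    have "V - {v} \<union> H \<in> ?J" using inJ[of "V - {v}" H] v H by auto
    moreover have "F \<subseteq> V - {v} \<union> H" using F v H by auto
    moreover have "card (V - {v} \<union> H) = m + n" using cardU[of "V - {v}" H] H v cm by auto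
    ultimately show "\<exists>H\<in>?J. F \<subseteq> H \<and> card H = m + n" by blast
  next
    fix G assume "G \<in> ?J" and cG: "Suc (card G) = m + n"
    from \<open>G \<in> ?J\<close> obtain A B where F: "G = A \<union> B" "A \<subset> V" "B \<in> S" by (rule JE)
    have cAB: "Suc (card A + card B) = m + n" using F cardU[of A B] cG by auto
    show "\<exists>H\<in>?J. \<exists>H'\<in>?J. H \<noteq> H' \<and> G \<subseteq> H \<and> G \<subseteq> H' \<and> card H = m + n \<and> card H' = m + n"
    proof (cases "card B = n")
      case True
      have "card (V - A) = 2"
        using card_Diff_subset[of A V] F join.hyps(1) m cAB True
        by (simp add: finite_subset psubset_eq)
      then obtain v w where vw: "V - A = {v, w}" "v \<noteq> w" by (auto simp: card_2_iff)
      have "v \<in> V" "w \<in> V" "v \<notin> B" "w \<notin> B" using vw F join.hyps by auto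
      then have "V - {v} \<union> B \<in> ?J" "V - {w} \<union> B \<in> ?J" "V - {v} \<union> B \<noteq> V - {w} \<union> B"
        "card (V - {v} \<union> B) = m + n" "card (V - {w} \<union> B) = m + n"
        using inJ[of "V - {v}" B] inJ[of "V - {w}" B] cardU[of "V - {v}" B] cardU[of "V - {w}" B]
          cm True F vw by auto
      moreover have "G \<subseteq> V - {v} \<union> B" "G \<subseteq> V - {w} \<union> B" using vw F by auto
      ultimately show ?thesis
        by - (rule bexI[of _ "V - {v} \<union> B"], rule bexI[of _ "V - {w} \<union> B"], intro conjI)
    next
      case False
      then have cA: "card A = m" and cB: "Suc (card B) = n"
        using cAB Vle[OF F(2)] le[OF F(3)] by simp_all
      obtain H H' where H: "H \<in> S" "H' \<in> S" "H \<noteq> H'" "B \<subseteq> H" "B \<subseteq> H'" "card H = n" "card H' = n"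
        using two[OF F(3) cB] by (elim bexE conjE) (rule that)
      have "A \<inter> H = {}" "A \<inter> H' = {}" using H(1,2) F(2) join.hyps(4) by blast+
      then have "A \<union> H \<noteq> A \<union> H'" using H(3) by blast
      moreover have "A \<union> H \<in> ?J" "A \<union> H' \<in> ?J"
        using inJ[OF F(2) H(1)] inJ[OF F(2) H(2)] by simp_all
      moreover have "card (A \<union> H) = m + n" "card (A \<union> H') = m + n"
        using cardU[of A H] cardU[of A H'] F(2) H(1,2,6,7) cA by auto
      moreover have "G \<subseteq> A \<union> H" "G \<subseteq> A \<union> H'" using F(1) H(4,5) by blast+
      ultimately show ?thesis
        by - (rule bexI[of _ "A \<union> H"], rule bexI[of _ "A \<union> H'"], intro conjI)
    qed
  qed
qed

lemma ball_bd_ps_ball: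
  assumes V: "finite V" "V \<noteq> {}" and S: "ps_sphere S" and disj: "V \<inter> \<Union>S = {}"
  shows "ball_bd (asc_join (Pow V) S) = asc_join (simplex_bd V) S"
proof -
  let ?J = "asc_join (Pow V) S"
  obtain n where ascS: "asc S"
    and n: "\<forall>F\<in>S. card F \<le> n \<and> (\<exists>H\<in>S. F \<subseteq> H \<and> card H = n)"
      "\<forall>G\<in>S. Suc (card G) = n \<longrightarrow>
         (\<exists>H\<in>S. \<exists>H'\<in>S. H \<noteq> H' \<and> G \<subseteq> H \<and> G \<subseteq> H' \<and> card H = n \<and> card H' = n)"
    using ps_sphere_structure[OF S] by (elim conjE exE) (rule that)
  have le: "\<And>F. F \<in> S \<Longrightarrow> card F \<le> n"
    and ex: "\<And>F. F \<in> S \<Longrightarrow> \<exists>H\<in>S. F \<subseteq> H \<and> card H = n"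
    using n(1) by simp_all
  note two = n(2)[rule_format]
  have finS: "finite S" "{} \<in> S" "\<And>F. F \<in> S \<Longrightarrow> finite F" "\<And>F G. F \<in> S \<Longrightarrow> G \<subseteq> F \<Longrightarrow> G \<in> S"
    using ascS by (auto simp: asc_def)
  have cardU: "card (A \<union> B) = card A + card B" if "A \<subseteq> V" "B \<in> S" for A B
    using that disj V finS(3)[of B] by (intro card_Un_disjoint) (auto intro: finite_subset)
  have inJ: "A \<union> B \<in> ?J" if "A \<subseteq> V" "B \<in> S" for A B
    using that by (auto simp: asc_join_def)
  have JE: thesis
    if "F \<in> ?J" "\<And>A B. F = A \<union> B \<Longrightarrow> A \<subseteq> V \<Longrightarrow> B \<in> S \<Longrightarrow> thesis" for F thesis
    using that(1) unfolding asc_join_def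
    by (elim CollectE exE conjE) (rule that(2), simp_all)
  define m where "m = card V"
  have finJ: "finite ?J"
  proof -
    have "?J = (\<lambda>(A, B). A \<union> B) ` (Pow V \<times> S)" by (auto simp: asc_join_def)
    then show ?thesis using V finS(1) by simp
  qed
  have leJ: "card F \<le> m + n" if "F \<in> ?J" for F
  proof -
    obtain A B where F: "F = A \<union> B" "A \<subseteq> V" "B \<in> S" using \<open>F \<in> ?J\<close> by (rule JE)
    then show ?thesis using cardU[of A B] le[of B] card_mono[OF V(1), of A] by (auto simp: m_def)
  qed
  obtain T where T: "T \<in> S" "card T = n" using ex finS(2) by blast
  have "asc_dim ?J = int (m + n) - 1"
    unfolding asc_dim_def
  proof (rule Max_eqI)
    show "finite (face_dim ` ?J)" using finJ by simp
    show "y \<le> int (m + n) - 1" if "y \<in> face_dim ` ?J" for y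
      using that leJ by (force simp: face_dim_def)
    have "face_dim (V \<union> T) = int (m + n) - 1"
      using cardU[of V T] T by (simp add: face_dim_def m_def)
    then show "int (m + n) - 1 \<in> face_dim ` ?J" using inJ[of V T] T by (metis image_eqI order_refl)
  qed
  then have dimJ: "face_dim G = asc_dim ?J - 1 \<longleftrightarrow> Suc (card G) = m + n" for G
    by (auto simp: face_dim_def)
  have facetI: "V \<union> H \<in> facets ?J" if H: "H \<in> S" "card H = n" for H
    unfolding facets_def
  proof (intro CollectI conjI ballI impI)
    show "V \<union> H \<in> ?J" using inJ[of V H] H by simp
    fix G assume G: "G \<in> ?J" "V \<union> H \<subseteq> G"
    obtain A B where F: "G = A \<union> B" "A \<subseteq> V" "B \<in> S" using G(1) by (rule JE)
    have "finite G" using F finite_subset[of A V] V(1) finS(3)[of B] by simp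
    moreover have "card G \<le> card (V \<union> H)" using leJ[OF G(1)] cardU[of V H] H by (simp add: m_def)
    ultimately show "G = V \<union> H" using G(2) card_seteq by metis
  qed
  have facetE: "\<exists>H\<in>S. F = V \<union> H \<and> card H = n" if F: "F \<in> facets ?J" for F
  proof -
    have "F \<in> ?J" using F by (simp add: facets_def)
    then obtain A B where AB: "F = A \<union> B" "A \<subseteq> V" "B \<in> S" by (rule JE)
    obtain H where H: "H \<in> S" "B \<subseteq> H" "card H = n" using ex AB by blast
    have "V \<union> H \<in> ?J" using inJ[of V H] H by simp
    moreover have "F \<subseteq> V \<union> H" using AB H by auto
    ultimately have "V \<union> H = F" using F unfolding facets_def by blast
    then show ?thesis using H by blast
  qed
  have key: "(\<exists>!H. H \<in> facets ?J \<and> A \<union> B \<subseteq> H) \<longleftrightarrow> card B = n"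
    if AB: "A \<subseteq> V" "B \<in> S" "Suc (card (A \<union> B)) = m + n" for A B
  proof
    assume B: "card B = n"
    show "\<exists>!H. H \<in> facets ?J \<and> A \<union> B \<subseteq> H"
    proof (rule ex1I[of _ "V \<union> B"])
      show "V \<union> B \<in> facets ?J \<and> A \<union> B \<subseteq> V \<union> B" using facetI[OF AB(2) B] AB by auto
      fix K assume K: "K \<in> facets ?J \<and> A \<union> B \<subseteq> K"
      then obtain H where H: "H \<in> S" "K = V \<union> H" "card H = n" using facetE by blast
      have "B \<subseteq> H" using K H AB disj by blast
      then have "B = H" using H B finS(3)[of H] by (simp add: card_subset_eq)
      then show "K = V \<union> B" using H by simp
    qed
  next
    assume u: "\<exists>!H. H \<in> facets ?J \<and> A \<union> B \<subseteq> H"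
    show "card B = n"
    proof (rule ccontr)
      assume "card B \<noteq> n"
      then have cB: "Suc (card B) = n"
        using cardU[OF AB(1,2)] AB le[of B] card_mono[OF V(1) AB(1)] by (simp add: m_def)
      then obtain H H' where H: "H \<in> S" "H' \<in> S" "H \<noteq> H'" "B \<subseteq> H" "B \<subseteq> H'" "card H = n" "card H' = n"
        using two[OF AB(2) cB] by (elim bexE conjE) (rule that)
      have "V \<inter> H = {}" "V \<inter> H' = {}" using H(1,2) disj by blast+
      then have "V \<union> H \<noteq> V \<union> H'" using H(3) by blast
      moreover have "A \<union> B \<subseteq> V \<union> H" "A \<union> B \<subseteq> V \<union> H'" using H(4,5) AB(1) by blast+
      ultimately show False using u facetI[of H] facetI[of H'] H by blast
    qed
  qed
  show ?thesis
  proof (intro equalityI subsetI)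
    fix F assume "F \<in> ball_bd ?J"
    then obtain G where G: "G \<in> ?J" "F \<subseteq> G" "Suc (card G) = m + n"
      "\<exists>!H. H \<in> facets ?J \<and> G \<subseteq> H"
      unfolding ball_bd_def dimJ by blast
    obtain A B where AB: "G = A \<union> B" "A \<subseteq> V" "B \<in> S" using G(1) by (rule JE)
    have "card B = n" using key[of A B] AB G by simp
    then have "A \<noteq> V" using G AB cardU[of A B] by (auto simp: m_def)
    then have "F \<inter> A \<in> simplex_bd V" using AB by (auto simp: simplex_bd_def)
    moreover have "F \<inter> B \<in> S" using finS(4)[of B "F \<inter> B"] AB by simp
    moreover have "F = (F \<inter> A) \<union> (F \<inter> B)" using G AB by auto
    ultimately show "F \<in> asc_join (simplex_bd V) S" unfolding asc_join_def by blast
  next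
    fix F assume "F \<in> asc_join (simplex_bd V) S"
    then obtain A B where AB: "F = A \<union> B" "A \<subset> V" "B \<in> S"
      by (auto simp: asc_join_def simplex_bd_def)
    obtain H where H: "H \<in> S" "B \<subseteq> H" "card H = n" using ex AB by blast
    obtain v where v: "v \<in> V" "v \<notin> A" using AB by auto
    let ?G = "(V - {v}) \<union> H"
    have c: "Suc (card ?G) = m + n"
      using cardU[of "V - {v}" H] H v V by (simp add: m_def card_gt_0_iff)
    have "?G \<in> ?J" using inJ[of "V - {v}" H] H by auto
    moreover have "F \<subseteq> ?G" using AB H v by auto
    moreover have "face_dim ?G = asc_dim ?J - 1" using c by (simp only: dimJ)
    moreover have "\<exists>!K. K \<in> facets ?J \<and> ?G \<subseteq> K" using key[of "V - {v}" H] H c by auto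
    ultimately show "F \<in> ball_bd ?J"
      unfolding ball_bd_def by - (rule CollectI, rule bexI[of _ ?G], intro conjI)
  qed
qed

end

(*
  With n vertices, e edges and f triangles, h_1 = n - 3, q := h_2 - h_1 = e - 3n + 6 and
  h_3 = f - e + n - 1. Consider the 1-skeleton of the whole complex and introduce the vertices in the
  order of the ears: after the starting sphere, each new vertex has at least three earlier neighbours,
  and only the neighbours and the excess q matter for the number of new triangles. By induction this
  gives h_3 <= h_2 + phi q, where phi q is Macaulay's bound for the number of cubics all of whose
  quadratic divisors lie in a set of q quadratic monomials. The four kinds of PS balls add (1,1,1),
  (1,2,1), (0,1,1) or (0,0,1) to (h_1,h_2,h_3), so h_3 > q, and h_3 >= h_1 - 1 or h_3 = h_1 - 2; the
  latter happens only for the octahedron with ears of the first two kinds attached. The last case is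
  realised by xyz, cubes w^3 and monomials x u^2. In the others take a cone variable x_0, a set Q of q
  quadratic monomials in the other variables, the cubics x_0 m for m in Q, some x_0^2 x_j, and some
  cubics with all quadratic divisors in Q: if h_3 >= h_2 choose Q as a colex segment, otherwise choose
  Q so that it contains enough squares.
*)

theory Submission
  imports Defs
begin

section \<open>Macaulay's bound in degree two\<close>

text \<open>If \<open>q = (a + 1 choose 2) + (b choose 1)\<close> with \<open>b \<le> a\<close>, then \<open>colex q = (a, b)\<close>, and \<open>phi q\<close> is
  obtained by raising both entries of each of the two binomial coefficients by one.\<close>

fun colex :: "nat \<Rightarrow> nat \<times> nat" where
  "colex 0 = (0, 0)"
| "colex (Suc q) = (case colex q of (a, b) \<Rightarrow> if b < a then (a, Suc b) else (Suc a, 0))"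

definition phi :: "nat \<Rightarrow> nat" where
  "phi q = (case colex q of (a, b) \<Rightarrow> (a + 2 choose 3) + (Suc b choose 2))"

lemma choose_2_Suc: "(Suc n choose 2) = (n choose 2) + n"
  by (simp add: numeral_2_eq_2)

lemma choose_3_Suc: "(Suc n choose 3) = (n choose 3) + (n choose 2)"
  by (simp add: numeral_2_eq_2 numeral_3_eq_3)

text \<open>Doubling turns the binomial coefficient into a polynomial, so that inequalities between
  such coefficients reduce to ring normalisation.\<close>

lemma choose_2_double: "2 * (Suc n choose 2) = n * n + n"
  by (induction n) (simp_all add: choose_2_Suc)

lemma colex_eq: "b \<le> a \<Longrightarrow> colex ((Suc a choose 2) + b) = (a, b)"
proof (induction a arbitrary: b)
  case 0
  then show ?case by (simp add: numeral_2_eq_2)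
next
  case (Suc a)
  note IH = Suc.IH
  show ?case using Suc.prems
  proof (induction b)
    case 0
    have "(Suc (Suc a) choose 2) + 0 = Suc ((Suc a choose 2) + a)"
      by (simp add: choose_2_Suc[of "Suc a"])
    then show ?case using IH[of a] by simp
  qed simp
qed

lemma colex_cases:
  obtains a b where "q = (Suc a choose 2) + b" "b \<le> a"
proof (induction q arbitrary: thesis)
  case 0
  show ?case by (rule 0[of 0 0]) simp_all
next
  case (Suc q)
  obtain a b where ab: "q = (Suc a choose 2) + b" "b \<le> a" by (rule Suc.IH)
  show ?case
  proof (cases "b < a")
    case True
    then show ?thesis using ab by (intro Suc.prems[of a "Suc b"]) simp_all
  next
    case False
    then show ?thesis using ab by (intro Suc.prems[of "Suc a" 0]) (simp_all add: choose_2_Suc)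
  qed
qed

lemma phi_eq: "b \<le> a \<Longrightarrow> phi ((Suc a choose 2) + b) = (a + 2 choose 3) + (Suc b choose 2)"
  by (simp add: phi_def colex_eq)

section \<open>Growth of Macaulay's bound\<close>

text \<open>For \<open>colex q = (a, b)\<close> the increment is b + 1 in both cases, so the
  increments of \<open>phi\<close> run through the blocks 1; 1, 2; 1, 2, 3; and so on.\<close>

lemma phi_Suc: "phi q + 1 \<le> phi (Suc q)"
proof -
  obtain a b where ab: "q = (Suc a choose 2) + b" "b \<le> a" by (rule colex_cases)
  show ?thesis
  proof (cases "b < a")
    case True
    then have "phi (Suc q) = (a + 2 choose 3) + (Suc (Suc b) choose 2)"
      using phi_eq[of "Suc b" a] ab by simp
    then show ?thesis using phi_eq[OF ab(2)] ab by (simp add: choose_2_Suc)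
  next
    case False
    then have "Suc q = (Suc (Suc a) choose 2) + 0" using ab by (simp add: choose_2_Suc)
    then have "phi (Suc q) = (Suc a + 2 choose 3)" using phi_eq[of 0 "Suc a"] by simp
    then show ?thesis using phi_eq[OF ab(2)] ab False by (simp add: choose_2_Suc choose_3_Suc)
  qed
qed

lemma phi_add: "phi q + s \<le> phi (q + s)"
proof (induction s)
  case (Suc s)
  then show ?case using phi_Suc[of "q + s"] by simp
qed simp

lemma choose_2_mono: "m \<le> n \<Longrightarrow> (m choose 2) \<le> (n choose 2)"
  by (rule binomial_right_mono)

lemma choose_2_less: "(n choose 2) < (m choose 2) \<Longrightarrow> n < m"
  using choose_2_mono[of m n] by (meson leD leI)

text \<open>The left side gains 1 + ... + s, the right side s consecutive increments of
  \<open>phi\<close>. The hypothesis makes s at most a + 1, so these lie in at most two blocks. If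
  they run past the end of the first block, the entries missing from 1, ..., s are replaced by
  larger ones.\<close>

lemma phi_increment_large:
  assumes q: "(s choose 2) \<le> q"
  shows "phi q + (Suc s choose 2) \<le> phi (q + s)"
proof -
  obtain a b where ab: "q = (Suc a choose 2) + b" "b \<le> a" by (rule colex_cases)
  have "(s choose 2) < (Suc (Suc a) choose 2)"
    using q ab by (simp add: choose_2_Suc[of "Suc a"])
  then have s: "s \<le> Suc a" using choose_2_less by fastforce
  show ?thesis
  proof (cases "b + s \<le> a")
    case True
    have "phi (q + s) = (a + 2 choose 3) + (Suc (b + s) choose 2)"
      using phi_eq[OF True] ab by (simp add: add.assoc)
    moreover have "2 * (Suc (b + s) choose 2) \<ge> 2 * (Suc b choose 2) + 2 * (Suc s choose 2)"
      unfolding choose_2_double by (simp add: algebra_simps)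
    ultimately show ?thesis using phi_eq[OF ab(2)] ab by simp
  next
    case False
    \<comment> \<open>Crossing the end of the block leads to the pair (a + 1, r).\<close>
    define r where "r = b + s - Suc a"
    have r: "Suc a + r = b + s" "r \<le> Suc a" using False s ab by (simp_all add: r_def)
    have "q + s = (Suc (Suc a) choose 2) + r"
      using r ab by (simp add: choose_2_Suc[of "Suc a"])
    then have "phi (q + s) = (Suc a + 2 choose 3) + (Suc r choose 2)"
      using phi_eq[OF r(2)] by simp
    moreover have "2 * (Suc (Suc a) choose 2) + 2 * (Suc r choose 2)
        \<ge> 2 * (Suc b choose 2) + 2 * (Suc s choose 2)"
    proof -
      \<comment> \<open>With b = r + y and s = r + x the two sides of the goal differ by exactly 2 x
        y.\<close>
      obtain x y where xy: "Suc a = b + x" "Suc a = s + y"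
        using s ab by (metis le_Suc_eq le_iff_add)
      have bs: "b = r + y" "s = r + x" "Suc a = r + x + y" using r xy by simp_all
      show ?thesis unfolding choose_2_double bs by (simp add: algebra_simps)
    qed
    ultimately show ?thesis using phi_eq[OF ab(2)] ab by (simp add: choose_3_Suc)
  qed
qed

text \<open>Passing from (a, b) to (a + 1, b + 1) adds a + 2 to q and, by Pascal's rule, q + a + 2
  to \<open>phi\<close>. This is equality for s = a + 2, and each further increment is at least 1.
  For s = a + 1 the hypothesis forces b = 0 and the step leads to (a + 1, 0); for s at most a it
  forces q = s = 0.\<close>

lemma phi_increment_small:
  assumes q: "q \<le> (s choose 2)"
  shows "phi q + q + s \<le> phi (q + s)"
proof -
  obtain a b where ab: "q = (Suc a choose 2) + b" "b \<le> a" by (rule colex_cases)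
  have phiq: "phi q = (a + 2 choose 3) + (Suc b choose 2)" using phi_eq ab by simp
  \<comment> \<open>The last condition admits b' = b + 1 and, when b = 0, also b' = 0.\<close>
  have eq: "phi q + q + s' = phi (q + s')"
    if s': "q + s' = (Suc (Suc a) choose 2) + b'" "b' \<le> Suc a" "(Suc b choose 2) = (b' choose 2)" for s' b'
  proof -
    have "phi (q + s') = (Suc a + 2 choose 3) + (Suc b' choose 2)"
      using phi_eq[OF s'(2)] s'(1) by simp
    then show ?thesis using s' phiq by (simp add: choose_3_Suc choose_2_Suc)
  qed
  consider "a + 2 \<le> s" | "s = Suc a" | "s \<le> a" by linarith
  then show ?thesis
  proof cases
    case 1
    have "phi q + q + (a + 2) = phi (q + (a + 2))"
      by (rule eq[of _ "Suc b"]) (use ab in \<open>simp_all add: choose_2_Suc\<close>)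
    moreover have "phi (q + (a + 2)) + (s - (a + 2)) \<le> phi (q + (a + 2) + (s - (a + 2)))"
      by (rule phi_add)
    moreover have "q + (a + 2) + (s - (a + 2)) = q + s" using 1 by simp
    ultimately have "phi q + q + (a + 2) + (s - (a + 2)) \<le> phi (q + s)" by metis
    then show ?thesis using 1 by simp
  next
    case 2
    then have "b = 0" using q ab by simp
    then have "phi q + q + s = phi (q + s)"
      by (intro eq[of _ 0]) (use ab 2 in \<open>simp_all add: choose_2_Suc\<close>)
    then show ?thesis by simp
  next
    case 3
    then have "(s choose 2) \<le> (a choose 2)" by (rule choose_2_mono)
    then have "a = 0" "q = 0" using q ab by (simp_all add: choose_2_Suc)
    then show ?thesis using 3 by simp
  qed
qed

section \<open>Pure multicomplexes of degree three\<close>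

lemma finite_submultisets: "finite {m. m \<subseteq># c}"
proof (rule finite_subset)
  show "{m. m \<subseteq># c} \<subseteq> mset ` {xs. set xs \<subseteq> set_mset c \<and> length xs \<le> size c}"
  proof
    fix m assume "m \<in> {m. m \<subseteq># c}"
    then have "set_mset m \<subseteq> set_mset c" "size m \<le> size c"
      by (auto dest: mset_subset_eqD size_mset_mono)
    moreover obtain xs where "m = mset xs" by (metis ex_mset)
    ultimately show "m \<in> mset ` {xs. set xs \<subseteq> set_mset c \<and> length xs \<le> size c}" by auto
  qed
qed (simp add: finite_lists_length_le)

text \<open>Every monomial of the multicomplex generated by \<open>C\<close> divides a cubic in
  \<open>C\<close>, so all maximal monomials are cubics and purity is automatic. A realisation then
  only requires counting the linear and quadratic divisors of a set of cubics.\<close>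

lemma pure_O_sequence_generated:
  fixes C :: "monomial set"
  assumes C: "finite C" "C \<noteq> {}" "\<And>c. c \<in> C \<Longrightarrow> size c = 3"
  shows "pure_O_sequence [1, int (card {m. size m = 1 \<and> (\<exists>c\<in>C. m \<subseteq># c)}),
    int (card {m. size m = 2 \<and> (\<exists>c\<in>C. m \<subseteq># c)}), int (card C)]"
proof -
  define M where "M = {m. \<exists>c\<in>C. m \<subseteq># c}"
  have "M = (\<Union>c\<in>C. {m. m \<subseteq># c})" by (auto simp: M_def)
  then have fin: "finite M" using C(1) by (simp add: finite_submultisets)
  obtain c0 where c0: "c0 \<in> C" using C(2) by blast
  have CM: "C \<subseteq> M" by (auto simp: M_def)
  have mult: "multicomplex M"
    unfolding multicomplex_def using fin c0 CM by (auto simp: M_def intro: subset_mset.order_trans)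
  have size_le: "size m \<le> 3" if m: "m \<in> M" for m
  proof -
    obtain c where "c \<in> C" "m \<subseteq># c" using m by (auto simp: M_def)
    then show ?thesis using C(3) size_mset_mono by fastforce
  qed
  have size3: "{m \<in> M. size m = 3} = C"
  proof (intro equalityI subsetI)
    fix m assume "m \<in> {m \<in> M. size m = 3}"
    then obtain c where c: "c \<in> C" "m \<subseteq># c" "size m = 3" unfolding M_def by blast
    then have "m = c" using C(3)[OF c(1)]
      by (metis subset_mset.le_imp_less_or_eq mset_subset_size nat_less_le)
    then show "m \<in> C" using c by simp
  qed (use CM C(3) in auto)
  have pure: "pure_multicomplex M"
  proof -
    have "size m = 3" if m: "m \<in> maximal_monomials M" for m
    proof -
      obtain c where "c \<in> C" "m \<subseteq># c" using m unfolding M_def maximal_monomials_def by blast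
      then have "c = m" using m CM by (auto simp: maximal_monomials_def)
      then show ?thesis using C(3) \<open>c \<in> C\<close> by simp
    qed
    then show ?thesis using mult by (simp add: pure_multicomplex_def)
  qed
  have "Max (size ` M) = 3"
    using fin size_le c0 CM C(3)[OF c0] by (intro Max_eqI) (auto intro: rev_image_eqI)
  moreover have "{m \<in> M. size m = 0} = {{#}}" using c0 by (auto simp: M_def)
  ultimately have "F_vector M = [1, card {m \<in> M. size m = 1}, card {m \<in> M. size m = 2}, card C]"
    using size3 by (simp add: F_vector_def eval_nat_numeral upt_rec)
  moreover have "{m \<in> M. size m = k} = {m. size m = k \<and> (\<exists>c\<in>C. m \<subseteq># c)}" for k
    by (auto simp: M_def)
  ultimately have "map int (F_vector M) = [1, int (card {m. size m = 1 \<and> (\<exists>c\<in>C. m \<subseteq># c)}),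
      int (card {m. size m = 2 \<and> (\<exists>c\<in>C. m \<subseteq># c)}), int (card C)]"
    by (simp add: eval_nat_numeral)
  then show ?thesis unfolding pure_O_sequence_def using pure by metis
qed

text \<open>The variable \<open>0\<close> is left out because it serves as the cone variable.\<close>

definition monomials :: "nat \<Rightarrow> nat \<Rightarrow> monomial set" where
  "monomials n k = {m. size m = k \<and> set_mset m \<subseteq> {1..n}}"

lemma monomials_0 [simp]: "monomials n 0 = {{#}}"
  by (auto simp: monomials_def)

lemma monomials_0_Suc: "monomials 0 (Suc k) = {}"
  by (auto simp: monomials_def)

text \<open>Pascal's rule for monomials, according to whether the last variable occurs.\<close>

lemma monomials_Suc_Suc:
  "monomials (Suc n) (Suc k) = monomials n (Suc k) \<union> add_mset (Suc n) ` monomials (Suc n) k"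
proof (intro equalityI subsetI)
  fix m assume m: "m \<in> monomials (Suc n) (Suc k)"
  show "m \<in> monomials n (Suc k) \<union> add_mset (Suc n) ` monomials (Suc n) k"
  proof (cases "Suc n \<in># m")
    case True
    then obtain m' where "m = add_mset (Suc n) m'" by (meson mset_add)
    then show ?thesis using m by (auto simp: monomials_def)
  next
    case False
    then have "set_mset m \<subseteq> {1..n}" using m by (force simp: monomials_def le_Suc_eq)
    then show ?thesis using m by (auto simp: monomials_def)
  qed
qed (force simp: monomials_def)+

lemma finite_monomials: "finite (monomials n k)"
proof (rule finite_subset)
  show "monomials n k \<subseteq> mset ` {xs. set xs \<subseteq> {1..n} \<and> length xs = k}"
  proof
    fix m assume "m \<in> monomials n k"
    then show "m \<in> mset ` {xs. set xs \<subseteq> {1..n} \<and> length xs = k}"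
      by (metis (mono_tags, lifting) ex_mset image_eqI mem_Collect_eq monomials_def set_mset_mset size_mset)
  qed
qed (simp add: finite_lists_length_eq)

lemma card_add_mset_image: "card (add_mset x ` A) = card A"
  by (rule card_image) (simp add: inj_on_def)

lemma card_monomials: "card (monomials n (Suc k)) = (n + k) choose (Suc k)"
proof (induction k arbitrary: n)
  case 0
  have "monomials n (Suc 0) = (\<lambda>i. {#i#}) ` {1..n}"
    by (force simp: monomials_def
        dest: size_1_singleton_mset[OF trans[OF _ One_nat_def[symmetric]]])
  then show ?case by (simp add: card_image inj_on_def)
next
  case (Suc k)
  note IH = Suc
  show ?case
  proof (induction n)
    case (Suc n)
    have "monomials n (Suc (Suc k)) \<inter> add_mset (Suc n) ` monomials (Suc n) (Suc k) = {}"
      by (auto simp: monomials_def)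
    then show ?case using Suc IH[of "Suc n"]
      by (simp add: monomials_Suc_Suc[of n "Suc k"] card_Un_disjoint card_add_mset_image finite_monomials)
  qed (simp add: monomials_0_Suc)
qed

lemma subset_add_mset_notin: "x \<notin># m \<Longrightarrow> m \<subseteq># add_mset x c \<longleftrightarrow> m \<subseteq># c"
  by (simp flip: Diff_eq_empty_iff_mset)

section \<open>The cone construction\<close>

text \<open>The generating cubics are x_0^2 x_j for j in \<open>J\<close>, x_0 m for m in
  \<open>Q\<close>, and those in \<open>D\<close>. Their quadratic divisors are all x_0 x_j together
  with \<open>Q\<close>: \<open>QD\<close> keeps the divisors of \<open>D\<close> inside
  \<open>Q\<close>, a nonempty \<open>J\<close> yields x_0^2, and the last condition on
  \<open>J\<close> yields x_0 x_j from x_0 m when x_0^2 x_j is left out.\<close>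

lemma pure_O_sequence_cone:
  assumes Q: "Q \<subseteq> monomials n 2" and D: "D \<subseteq> monomials n 3"
    and QD: "\<And>c m. c \<in> D \<Longrightarrow> m \<subseteq># c \<Longrightarrow> size m = 2 \<Longrightarrow> m \<in> Q"
    and J: "J \<subseteq> {0..n}" "J \<noteq> {}" "\<And>i. i \<in> {1..n} \<Longrightarrow> i \<notin> J \<Longrightarrow> \<exists>m\<in>Q. i \<in># m"
  shows "pure_O_sequence [1, int (Suc n), int (Suc n + card Q), int (card J + card Q + card D)]"
proof -
  define A where "A = (\<lambda>j. {#0, 0, j#}) ` J"
  define B where "B = add_mset 0 ` Q"
  define C where "C = A \<union> B \<union> D"
  have fin: "finite J" "finite Q" "finite D"
    by (rule finite_subset[OF J(1)], simp) (rule finite_subset[OF Q finite_monomials],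
      rule finite_subset[OF D finite_monomials])
  have Q0: "size m = 2" "0 \<notin># m" "set_mset m \<subseteq> {1..n}" if "m \<in> Q" for m
    using subsetD[OF Q that] by (force simp: monomials_def)+
  have D0: "size m = 3" "0 \<notin># m" "set_mset m \<subseteq> {1..n}" if "m \<in> D" for m
    using subsetD[OF D that] by (force simp: monomials_def)+
  have "A \<inter> B = {}" "(A \<union> B) \<inter> D = {}" using Q0 D0 by (fastforce simp: A_def B_def)+
  then have cardC: "card C = card J + card Q + card D"
    using fin by (simp add: C_def card_Un_disjoint A_def B_def card_image inj_on_def)
  have C: "finite C" "C \<noteq> {}" using fin J(2) by (simp_all add: C_def A_def B_def)
  have C3: "size c = 3" if "c \<in> C" for c using that Q0 D0 by (auto simp: C_def A_def B_def)
  have Cvars: "set_mset c \<subseteq> {0..n}" if "c \<in> C" for c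
    using that Q0(3) D0(3) J(1) by (fastforce simp: C_def A_def B_def)
  obtain j0 where j0: "j0 \<in> J" using J(2) by blast
  have pairs: "\<exists>c\<in>C. {#0, j#} \<subseteq># c" if "j \<le> n" for j
  proof (cases "j \<in> J \<or> j = 0")
    case True
    then obtain i where "i \<in> J" "{#0, j#} \<subseteq># {#0, 0, i#}" using j0 by auto
    moreover from this have "{#0, 0, i#} \<in> C" by (auto simp: C_def A_def)
    ultimately show ?thesis by blast
  next
    case False
    then obtain m where m: "m \<in> Q" "j \<in># m" using J(3)[of j] \<open>j \<le> n\<close> by auto
    then have "{#0, j#} \<subseteq># add_mset 0 m" by simp
    moreover have "add_mset 0 m \<in> C" using m by (auto simp: C_def B_def)
    ultimately show ?thesis by blast
  qed
  have "{m. size m = 1 \<and> (\<exists>c\<in>C. m \<subseteq># c)} = (\<lambda>j. {#j#}) ` {0..n}"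
  proof (intro equalityI subsetI)
    fix m assume "m \<in> {m. size m = 1 \<and> (\<exists>c\<in>C. m \<subseteq># c)}"
    then obtain c where c: "c \<in> C" "m \<subseteq># c" "size m = 1" by blast
    obtain j where j: "m = {#j#}" using size_1_singleton_mset c(3) by blast
    then have "j \<in> {0..n}" using c Cvars[OF c(1)] by auto
    then show "m \<in> (\<lambda>j. {#j#}) ` {0..n}" using j by blast
  next
    fix m :: monomial assume "m \<in> (\<lambda>j. {#j#}) ` {0..n}"
    then obtain j where j: "m = {#j#}" "j \<le> n" by auto
    obtain c where "c \<in> C" "{#0, j#} \<subseteq># c" using pairs[OF j(2)] by blast
    then have "c \<in> C" "{#j#} \<subseteq># c" using mset_subset_eqD[of "{#0, j#}" c j] by auto
    then show "m \<in> {m. size m = 1 \<and> (\<exists>c\<in>C. m \<subseteq># c)}" unfolding j(1) by fastforce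
  qed
  then have F1: "card {m. size m = 1 \<and> (\<exists>c\<in>C. m \<subseteq># c)} = Suc n"
    by (simp add: card_image inj_on_def)
  have "{m. size m = 2 \<and> (\<exists>c\<in>C. m \<subseteq># c)} = (\<lambda>j. {#0, j#}) ` {0..n} \<union> Q" (is "?L = ?R")
  proof (intro equalityI subsetI)
    fix m assume "m \<in> ?L"
    then obtain c where c: "c \<in> C" "m \<subseteq># c" "size m = 2" by blast
    show "m \<in> ?R"
    proof (cases "0 \<in># m")
      case True
      then obtain m' where "m = add_mset 0 m'" by (meson mset_add)
      then obtain j where j: "m = {#0, j#}" using c(3) size_1_singleton_mset[of m'] by auto
      then have "j \<in># c" using c(2) mset_subset_eqD by fastforce
      then have "j \<in> {0..n}" using Cvars[OF c(1)] by auto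
      then show ?thesis using j by blast
    next
      case False
      consider "c \<in> D" | j where "c = {#0, 0, j#}" | q where "q \<in> Q" "c = add_mset 0 q"
        using c(1) by (auto simp: C_def A_def B_def)
      then show ?thesis
      proof cases
        case 1
        then show ?thesis using QD c by blast
      next
        case 2
        then have "m \<subseteq># {#j#}" using c(2) False by (simp add: subset_add_mset_notin)
        then show ?thesis using c(3) size_mset_mono by fastforce
      next
        case 3
        then have "m \<subseteq># q" using c(2) False by (simp add: subset_add_mset_notin)
        then have "m = q" using Q0(1)[OF 3(1)] c(3)
          by (metis mset_subset_size nat_less_le subset_mset.le_imp_less_or_eq)
        then show ?thesis using 3 by simp
      qed
    qed
  next
    fix m assume "m \<in> ?R"
    then consider j where "j \<le> n" "m = {#0, j#}" | "m \<in> Q" by auto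
    then show "m \<in> ?L"
    proof cases
      case 1
      then show ?thesis using pairs[of j] by auto
    next
      case 2
      then have "add_mset 0 m \<in> C" "m \<subseteq># add_mset 0 m" by (auto simp: C_def B_def)
      then show ?thesis using Q0(1)[OF 2] by blast
    qed
  qed
  moreover have "(\<lambda>j. {#0, j#}) ` {0..n} \<inter> Q = {}" using Q0(2) by fastforce
  ultimately have "card {m. size m = 2 \<and> (\<exists>c\<in>C. m \<subseteq># c)} = Suc n + card Q"
    using fin by (simp add: card_Un_disjoint card_image inj_on_def)
  then show ?thesis using pure_O_sequence_generated[OF C C3] F1 cardC by simp
qed

lemma card_monomials_2: "card (monomials n 2) = (Suc n choose 2)"
  using card_monomials[of n 1] by (simp add: numeral_2_eq_2)

lemma card_monomials_3: "card (monomials n 3) = (n + 2 choose 3)"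
  using card_monomials[of n 2] by (simp add: numeral_3_eq_3)

text \<open>\<open>Q\<close> consists of the quadratic monomials in the first a variables and the
  products of variable a + 1 with the first b; \<open>D\<close> of the cubics in the first a
  variables and the products of variable a + 1 with the quadratic monomials in the first b. As b is
  at most a, quadratic divisors of \<open>D\<close> lie in \<open>Q\<close>, and Macaulay's bound is
  attained.\<close>

lemma colex_segment:
  assumes q: "q \<le> (Suc n choose 2)"
  obtains Q D where "Q \<subseteq> monomials n 2" "card Q = q" "D \<subseteq> monomials n 3" "card D = phi q"
    "\<forall>c\<in>D. \<forall>m. m \<subseteq># c \<longrightarrow> size m = 2 \<longrightarrow> m \<in> Q"
proof -
  obtain a b where ab: "q = (Suc a choose 2) + b" "b \<le> a" by (rule colex_cases)
  define Q where "Q = monomials a 2 \<union> add_mset (Suc a) ` monomials b 1"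
  define D where "D = monomials a 3 \<union> add_mset (Suc a) ` monomials b 2"
  have "a \<le> n"
  proof (rule ccontr)
    assume "\<not> a \<le> n"
    then have "(Suc (Suc n) choose 2) \<le> (Suc a choose 2)" by (intro choose_2_mono) simp
    then have "(Suc n choose 2) < (Suc a choose 2)" by (simp add: choose_2_Suc[of "Suc n"])
    then show False using q ab by linarith
  qed
  \<comment> \<open>When b is positive, the variable a + 1 occurs in \<open>Q\<close> and must be
    one of the n variables.\<close>
  have "b = 0 \<or> Suc a \<le> n"
  proof (rule disjCI)
    assume "\<not> Suc a \<le> n"
    then have "n \<le> a" by simp
    then have "(Suc n choose 2) \<le> (Suc a choose 2)" by (intro choose_2_mono) simp
    then show "b = 0" using q ab by linarith
  qed
  show thesis
  proof (rule that)
    show "Q \<subseteq> monomials n 2" "D \<subseteq> monomials n 3"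
      using \<open>a \<le> n\<close> \<open>b = 0 \<or> Suc a \<le> n\<close> ab(2)
      by (auto simp: Q_def D_def monomials_def)
    have "monomials a 2 \<inter> add_mset (Suc a) ` monomials b 1 = {}"
      "monomials a 3 \<inter> add_mset (Suc a) ` monomials b 2 = {}"
      by (auto simp: monomials_def)
    then show "card Q = q" "card D = phi q"
      using ab phi_eq[OF ab(2)] card_monomials[of b 0]
      by (simp_all add: Q_def D_def card_Un_disjoint finite_monomials card_add_mset_image
        card_monomials_2 card_monomials_3)
  next
    have "m \<in> Q" if cm: "c \<in> D" "m \<subseteq># c" "size m = 2" for c m
    proof (cases "c \<in> monomials a 3")
      case True
      then show ?thesis using cm by (auto simp: Q_def monomials_def dest: set_mset_mono)
    next
      case False
      then obtain c' where c': "c = add_mset (Suc a) c'" "c' \<in> monomials b 2"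
        using cm(1) by (auto simp: D_def)
      show ?thesis
      proof (cases "Suc a \<in># m")
        case True
        then obtain m' where m': "m = add_mset (Suc a) m'" by (meson mset_add)
        then have "m' \<in> monomials b 1" using cm c' by (auto simp: monomials_def dest: set_mset_mono)
        then show ?thesis using m' by (simp add: Q_def)
      next
        case False
        then have "m \<subseteq># c'" using cm(2) c'(1) by (simp add: subset_add_mset_notin)
        then have "set_mset m \<subseteq> {1..b}" using c'(2) by (auto simp: monomials_def dest: set_mset_mono)
        then show ?thesis using cm(3) ab(2) by (force simp: Q_def monomials_def)
      qed
    qed
    then show "\<forall>c\<in>D. \<forall>m. m \<subseteq># c \<longrightarrow> size m = 2 \<longrightarrow> m \<in> Q" by blast
  qed
qed

section \<open>Realising the three kinds of vectors\<close>

text \<open>Using every x_0^2 x_j gives \<open>Suc n + q\<close> cubics. The remaining ones, at most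
  \<open>phi q\<close> in number, form a subset of the extremal set \<open>D\<close>, and any subset
  still has its quadratic divisors in \<open>Q\<close>.\<close>

lemma pure_O_sequence_large:
  assumes q: "q \<le> (Suc n choose 2)" and h3: "Suc n + q \<le> h3" "h3 \<le> Suc n + q + phi q"
  shows "pure_O_sequence [1, int (Suc n), int (Suc n + q), int h3]"
proof -
  obtain Q D where QD: "Q \<subseteq> monomials n 2" "card Q = q" "D \<subseteq> monomials n 3" "card D = phi q"
    "\<forall>c\<in>D. \<forall>m. m \<subseteq># c \<longrightarrow> size m = 2 \<longrightarrow> m \<in> Q" using q by (rule colex_segment)
  have "h3 - (Suc n + q) \<le> card D" using h3 QD(4) by simp
  then obtain D' where D': "D' \<subseteq> D" "card D' = h3 - (Suc n + q)"
    by (rule obtain_subset_with_card_n)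
  have "pure_O_sequence [1, int (Suc n), int (Suc n + card Q), int (card {0..n} + card Q + card D')]"
    by (rule pure_O_sequence_cone[OF QD(1)]) (use QD D' in auto)
  then show ?thesis using QD D' h3 by simp
qed

text \<open>With \<open>D\<close> empty, r of the n + 1 cubics x_0^2 x_j have to be omitted.
  Omitting x_0^3 is free as long as another one remains, and each of the other r - 1 costs a square
  x_j^2 in \<open>Q\<close>. Now n \<le> h3 means that q squares suffice, and q < h3 that
  \<open>J\<close> is nonempty.\<close>

lemma pure_O_sequence_small:
  assumes q: "q \<le> (Suc n choose 2)" and h3: "q < h3" "n \<le> h3" "h3 \<le> Suc n + q"
  shows "pure_O_sequence [1, int (Suc n), int (Suc n + q), int h3]"
proof -
  define r where "r = Suc n + q - h3"
  have r: "r \<le> n" "r \<le> Suc q" "r - 1 \<le> q" using h3 by (simp_all add: r_def)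
  let ?sq = "(\<lambda>i. {#i, i#}) ` {1..<r}"
  have "?sq \<subseteq> monomials n 2" using r(1) by (auto simp: monomials_def)
  moreover have "card ?sq = r - 1"
    by (subst card_image) (auto intro!: inj_onI dest!: arg_cong[of _ _ set_mset])
  ultimately obtain Q where Q: "?sq \<subseteq> Q" "Q \<subseteq> monomials n 2" "card Q = q"
    using exists_subset_between[of ?sq q "monomials n 2"] r(3) q
    by (auto simp: card_monomials_2 finite_monomials)
  have "pure_O_sequence [1, int (Suc n), int (Suc n + card Q), int (card {r..n} + card Q + card ({} :: monomial set))]"
  proof (rule pure_O_sequence_cone[OF Q(2)])
    fix i assume "i \<in> {1..n}" "i \<notin> {r..n}"
    then have "{#i, i#} \<in> ?sq" by simp
    then have "{#i, i#} \<in> Q" using Q(1) by (rule set_mp[rotated])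
    then show "\<exists>m\<in>Q. i \<in># m" by (rule bexI[rotated]) simp
  qed (use r(1) in simp_all)
  then show ?thesis using Q(3) h3 by (simp add: r_def)
qed

text \<open>The divisors of xyz realise (1, 3, 3, 1), the vector of the octahedron. A new cube w^3
  adds one monomial in each positive degree, as a cone over a triangle boundary does; x u^2 adds u,
  then u^2 and x u, then itself, as a cone over a 4-cycle does.\<close>

lemma pure_O_sequence_octahedral:
  "pure_O_sequence [1, int (3 + a + b), int (3 + a + 2 * b), int (1 + a + b)]"
proof -
  define A :: "monomial set" where "A = (\<lambda>i. {#i, i, i#}) ` {3..<3 + a}"
  define B :: "monomial set" where "B = (\<lambda>i. {#0, i, i#}) ` {3 + a..<3 + a + b}"
  define C where "C = {{#0, 1, 2#}} \<union> A \<union> B"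
  have C: "finite C" "C \<noteq> {}" by (simp_all add: C_def A_def B_def)
  have C3: "size c = 3" if "c \<in> C" for c using that by (auto simp: C_def A_def B_def)
  have "{{#0, 1, 2#}} \<inter> (A \<union> B) = {}"
    by (auto simp: A_def B_def dest!: arg_cong[of _ _ "\<lambda>m. count m 1"] split: if_splits)
  moreover have "A \<inter> B = {}"
    by (auto simp: A_def B_def dest!: arg_cong[of _ _ "\<lambda>m. count m 0"] split: if_splits)
  ultimately have dis: "{{#0, 1, 2#}} \<inter> A = {}" "({{#0, 1, 2#}} \<union> A) \<inter> B = {}" by blast+
  have fin: "finite A" "finite B" by (simp_all add: A_def B_def)
  have cA: "card A = a"
    unfolding A_def by (subst card_image) (auto intro!: inj_onI dest!: arg_cong[of _ _ set_mset])
  have cB: "card B = b"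
    unfolding B_def
    by (subst card_image) (auto intro!: inj_onI dest!: arg_cong[of _ _ set_mset] simp: doubleton_eq_iff)
  have cardC: "card C = 1 + a + b"
    unfolding C_def using dis fin cA cB by (simp add: card_Un_disjoint del: Un_insert_left Int_insert_left)
  have pairs: "{#0, 1#} \<subseteq># {#0, 1, 2::nat#}" "{#0, 2#} \<subseteq># {#0, 1, 2::nat#}" "{#1, 2#} \<subseteq># {#0, 1, 2::nat#}"
    by (simp_all add: subset_eq_diff_conv)
  have C_cases: thesis
    if "c \<in> C" "c = {#0, 1, 2#} \<Longrightarrow> thesis"
      "\<And>i. 3 \<le> i \<Longrightarrow> i < 3 + a \<Longrightarrow> c = {#i, i, i#} \<Longrightarrow> thesis"
      "\<And>i. 3 + a \<le> i \<Longrightarrow> i < 3 + a + b \<Longrightarrow> c = {#0, i, i#} \<Longrightarrow> thesis" for c thesis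
    using that by (auto simp: C_def A_def B_def)
  have "{m. size m = 1 \<and> (\<exists>c\<in>C. m \<subseteq># c)} = (\<lambda>j. {#j#}) ` {0..<3 + a + b}" (is "?L = ?R")
  proof (intro equalityI subsetI)
    fix m assume "m \<in> ?L"
    then obtain c where c: "c \<in> C" "m \<subseteq># c" "size m = 1" by blast
    obtain j where j: "m = {#j#}" using size_1_singleton_mset c(3) by blast
    then have "j \<in># c" using c(2) by simp
    then have "j < 3 + a + b" using c(1) by (auto elim!: C_cases)
    then show "m \<in> ?R" using j by simp
  next
    fix m assume "m \<in> ?R"
    then obtain j where j: "m = {#j#}" "j < 3 + a + b" by auto
    consider "j < 3" | "3 \<le> j" "j < 3 + a" | "3 + a \<le> j" by linarith
    then have "\<exists>c\<in>C. j \<in># c"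
    proof cases
      case 1
      then have "j \<in># {#0, 1, 2#}" by auto
      then show ?thesis by (auto simp: C_def)
    next
      case 2
      then have "{#j, j, j#} \<in> C" by (auto simp: C_def A_def)
      then show ?thesis by (rule bexI[rotated]) simp
    next
      case 3
      then have "{#0, j, j#} \<in> C" using j(2) by (auto simp: C_def B_def)
      then show ?thesis by (rule bexI[rotated]) simp
    qed
    then show "m \<in> ?L" using j by simp
  qed
  then have F1: "card {m. size m = 1 \<and> (\<exists>c\<in>C. m \<subseteq># c)} = 3 + a + b"
    by (simp add: card_image inj_on_def)
  \<comment> \<open>\<open>T\<close> comes from xyz, \<open>S\<close> from the squares in both other
    families, and \<open>R\<close> from the products x u.\<close>
  define T :: "monomial set" where "T = {{#0, 1#}, {#0, 2#}, {#1, 2#}}"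
  define S where "S = (\<lambda>i. {#i, i#}) ` {3..<3 + a + b}"
  define R :: "monomial set" where "R = (\<lambda>i. {#0, i#}) ` {3 + a..<3 + a + b}"
  \<comment> \<open>A quadratic divisor of a cubic arises by removing a single variable.\<close>
  have sub3: "m = {#y, z#} \<or> m = {#x, z#} \<or> m = {#x, y#}"
    if m: "m \<subseteq># {#x, y, z#}" "size m = 2" for m and x y z :: nat
  proof -
    obtain u where u: "{#x, y, z#} = m + u" using m(1) by (metis subset_mset.add_diff_inverse)
    then have "size m + size u = 3" by (metis size_union size_add_mset size_empty numeral_3_eq_3)
    then obtain w where w: "u = {#w#}" using m(2) size_1_singleton_mset[of u] by auto
    then have "m = {#x, y, z#} - {#w#}" "w \<in># {#x, y, z#}" using u by simp_all
    then show ?thesis by (auto simp: add_mset_commute)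
  qed
  have "{m. size m = 2 \<and> (\<exists>c\<in>C. m \<subseteq># c)} = T \<union> S \<union> R" (is "?L = ?R")
  proof (intro equalityI subsetI)
    fix m assume "m \<in> ?L"
    then obtain c where c: "c \<in> C" "m \<subseteq># c" "size m = 2" by blast
    from c(1) show "m \<in> ?R"
    proof (rule C_cases)
      assume "c = {#0, 1, 2#}"
      then show ?thesis using sub3[of m 0 1 2] c by (auto simp: T_def)
    next
      fix i assume "3 \<le> i" "i < 3 + a" "c = {#i, i, i#}"
      then show ?thesis using sub3[of m i i i] c by (auto simp: S_def)
    next
      fix i assume "3 + a \<le> i" "i < 3 + a + b" "c = {#0, i, i#}"
      then show ?thesis using sub3[of m 0 i i] c by (auto simp: S_def R_def)
    qed
  next
    fix m assume "m \<in> ?R"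
    then consider "m \<in> T" | "m \<in> S" | "m \<in> R" by blast
    then consider "m \<in> T" | i where "3 \<le> i" "i < 3 + a" "m = {#i, i#}"
      | i where "3 + a \<le> i" "i < 3 + a + b" "m = {#i, i#} \<or> m = {#0, i#}"
    proof cases
      case 2
      then obtain i where "3 \<le> i" "i < 3 + a + b" "m = {#i, i#}" by (auto simp: S_def)
      then show ?thesis using that(2)[of i] that(3)[of i] by linarith
    next
      case 3
      then show ?thesis using that by (auto simp: R_def)
    qed
    then show "m \<in> ?L"
    proof cases
      case 1
      then have "size m = 2" "m \<subseteq># {#0, 1, 2#}" using pairs by (auto simp: T_def)
      then show ?thesis by (auto simp: C_def)
    next
      case 2
      then have "{#i, i, i#} \<in> C" "m \<subseteq># {#i, i, i#}" "size m = 2" by (auto simp: C_def A_def)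
      then show ?thesis by blast
    next
      case 3
      then have "{#0, i, i#} \<in> C" "m \<subseteq># {#0, i, i#}" "size m = 2" by (auto simp: C_def B_def)
      then show ?thesis by blast
    qed
  qed
  moreover have "T \<inter> S = {}" "(T \<union> S) \<inter> R = {}"
    by (auto simp: T_def S_def R_def doubleton_eq_iff dest!: arg_cong[of _ _ set_mset])
  moreover have "card T = 3"
    by (auto simp: T_def card_insert_if doubleton_eq_iff dest!: arg_cong[of _ _ set_mset])
  moreover have "card S = a + b"
    unfolding S_def by (subst card_image) (auto intro!: inj_onI dest!: arg_cong[of _ _ set_mset])
  moreover have "card R = b" unfolding R_def by (subst card_image) (auto intro!: inj_onI)
  moreover have "finite S" "finite R" "finite T" by (simp_all add: S_def R_def T_def)
  ultimately have "card {m. size m = 2 \<and> (\<exists>c\<in>C. m \<subseteq># c)} = 3 + a + 2 * b"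
    by (simp add: card_Un_disjoint)
  then show ?thesis using pure_O_sequence_generated[OF C C3] F1 cardC by simp
qed

section \<open>Triangles in graphs with few edges\<close>

text \<open>\<open>E\<close> may be any set family, of which the two-element sets count, so a
  complex can serve as its own graph.\<close>

definition edge_count :: "'a set set \<Rightarrow> 'a set \<Rightarrow> nat" where
  "edge_count E N = card {F \<in> E. card F = 2 \<and> F \<subseteq> N}"

text \<open>These are the triangles of the graph, whether or not they are faces, so their number
  bounds that of the 2-faces from above.\<close>

definition triangle_count :: "'a set set \<Rightarrow> 'a set \<Rightarrow> nat" where
  "triangle_count E N = card {F. F \<subseteq> N \<and> card F = 3 \<and> (\<forall>G. G \<subseteq> F \<longrightarrow> card G = 2 \<longrightarrow> G \<in> E)}"

definition nbrs :: "'a set set \<Rightarrow> 'a \<Rightarrow> 'a set \<Rightarrow> 'a set" where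
  "nbrs E v W = {u \<in> W. {u, v} \<in> E}"

text \<open>A generically rigid graph in 3-space has at least \<open>3 * card N - 6\<close> edges. The predicate \<open>rigid_like\<close>
  collects what the induction over the vertices needs; the monotonicity of the excess bounds the number
  of edges among the neighbours of a new vertex.\<close>

definition excess :: "'a set set \<Rightarrow> 'a set \<Rightarrow> int" where
  "excess E N = int (edge_count E N) - 3 * int (card N) + 6"

definition rigid_like :: "'a set set \<Rightarrow> 'a set \<Rightarrow> bool" where
  "rigid_like E W \<longleftrightarrow> finite W \<and> 3 \<le> card W \<and> 0 \<le> excess E W \<and>
     (\<forall>N. N \<subseteq> W \<longrightarrow> 3 \<le> card N \<longrightarrow> excess E N \<le> excess E W) \<and>
     int (triangle_count E W) \<le> 3 * int (card W) - 8 + 2 * excess E W + int (phi (nat (excess E W)))"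

lemma edge_count_le:
  assumes "finite N"
  shows "edge_count E N \<le> (card N choose 2)"
proof -
  have "edge_count E N \<le> card {F. F \<subseteq> N \<and> card F = 2}"
    unfolding edge_count_def using assms by (intro card_mono) auto
  then show ?thesis using n_subsets[OF assms, of 2] by simp
qed

lemma edge_count_insert:
  assumes "finite W" "v \<notin> W"
  shows "edge_count E (insert v W) = edge_count E W + card (nbrs E v W)"
proof -
  let ?A = "{F \<in> E. card F = 2 \<and> F \<subseteq> W}" and ?B = "(\<lambda>u. {u, v}) ` nbrs E v W"
  have "{F \<in> E. card F = 2 \<and> F \<subseteq> insert v W} = ?A \<union> ?B"
  proof (intro equalityI subsetI)
    fix F assume F: "F \<in> {F \<in> E. card F = 2 \<and> F \<subseteq> insert v W}"
    show "F \<in> ?A \<union> ?B"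
    proof (cases "v \<in> F")
      case True
      then obtain u where "F = {u, v}" "u \<noteq> v" using F by (auto simp: card_2_iff)
      then show ?thesis using F by (auto simp: nbrs_def)
    next
      case False
      then show ?thesis using F by auto
    qed
  next
    fix F assume "F \<in> ?A \<union> ?B"
    then show "F \<in> {F \<in> E. card F = 2 \<and> F \<subseteq> insert v W}"
      using assms(2) by (auto simp: nbrs_def card_2_iff)
  qed
  moreover have "?A \<inter> ?B = {}" using assms(2) by auto
  moreover have "card ?B = card (nbrs E v W)"
    by (intro card_image inj_onI) (auto simp: doubleton_eq_iff)
  moreover have "finite ?A" "finite ?B" using assms(1) by (auto simp: nbrs_def)
  ultimately show ?thesis by (simp add: edge_count_def card_Un_disjoint)
qed

text \<open>A triangle through v is determined by its opposite edge, which joins two neighbours of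
  v.\<close>

lemma triangle_count_insert_le:
  assumes W: "finite W" "v \<notin> W"
  shows "triangle_count E (insert v W) \<le> triangle_count E W + edge_count E (nbrs E v W)"
proof -
  let ?tri = "\<lambda>F. card F = 3 \<and> (\<forall>G. G \<subseteq> F \<longrightarrow> card G = 2 \<longrightarrow> G \<in> E)"
  let ?A = "{F. F \<subseteq> W \<and> ?tri F}" and ?B = "insert v ` {F \<in> E. card F = 2 \<and> F \<subseteq> nbrs E v W}"
  have "{F. F \<subseteq> insert v W \<and> ?tri F} \<subseteq> ?A \<union> ?B"
  proof
    fix F assume F: "F \<in> {F. F \<subseteq> insert v W \<and> ?tri F}"
    show "F \<in> ?A \<union> ?B"
    proof (cases "v \<in> F")
      case True
      have c: "card (F - {v}) = 2" using F True by simp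
      then have "F - {v} \<in> E" using F by blast
      moreover have "u \<in> nbrs E v W" if "u \<in> F - {v}" for u
      proof -
        have "card {u, v} = 2" "{u, v} \<subseteq> F" using that True by auto
        then show ?thesis using F that by (auto simp: nbrs_def)
      qed
      moreover have "F = insert v (F - {v})" using True by blast
      ultimately show ?thesis using c by blast
    next
      case False
      then show ?thesis using F by auto
    qed
  qed
  moreover have fin: "finite (?A \<union> ?B)"
    using W(1) by (auto simp: nbrs_def)
  ultimately have "triangle_count E (insert v W) \<le> card (?A \<union> ?B)"
    unfolding triangle_count_def by (intro card_mono)
  also have "\<dots> \<le> card ?A + card ?B" by (rule card_Un_le)
  also have "card ?B \<le> edge_count E (nbrs E v W)"
    unfolding edge_count_def using W(1) by (intro card_image_le) (auto simp: nbrs_def)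
  finally show ?thesis by (simp add: triangle_count_def)
qed

lemma excess_card_3: "card N = 3 \<Longrightarrow> excess E N \<le> 0"
  using edge_count_le[of N E] card_ge_0_finite[of N] by (simp add: excess_def eval_nat_numeral)

text \<open>Let v have s + 3 neighbours; the excess then grows from q to q + s. The new triangles
  are at most as many as the edges among the neighbours. These number at most C(s + 3, 2) = 2 s + 3
  + C(s + 1, 2) trivially, and at most q + 3 s + 3 by monotonicity of the excess. The first bound
  serves when C(s, 2) \<le> q, the second otherwise; the increment estimates for \<open>phi\<close>
  turn both into the growth of the triangle bound.\<close>

lemma rigid_like_insert:
  assumes W: "rigid_like E W" and v: "v \<notin> W" and deg: "3 \<le> card (nbrs E v W)"
  shows "rigid_like E (insert v W)"
proof -
  define s where "s = card (nbrs E v W) - 3"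
  define q where "q = nat (excess E W)"
  have fin: "finite W" and q: "excess E W = int q"
    and mono: "\<And>N. N \<subseteq> W \<Longrightarrow> 3 \<le> card N \<Longrightarrow> excess E N \<le> int q"
    and tri: "int (triangle_count E W) \<le> 3 * int (card W) - 8 + 2 * int q + int (phi q)"
    using W by (auto simp: rigid_like_def q_def)
  have s: "card (nbrs E v W) = s + 3" using deg by (simp add: s_def)
  have subN: "nbrs E v W \<subseteq> W" by (auto simp: nbrs_def)
  then have finN: "finite (nbrs E v W)" using fin finite_subset by blast
  have ex: "excess E (insert v W) = int (q + s)"
    using q fin v s by (simp add: excess_def edge_count_insert)
  have "excess E N \<le> int (q + s)" if N: "N \<subseteq> insert v W" "3 \<le> card N" for N
  proof (cases "v \<in> N")
    case False
    then show ?thesis using mono[of N] N by force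
  next
    \<comment> \<open>Removing v loses one vertex and at most s + 3 edges, so the excess drops by at
      most s. If two vertices remain, \<open>N\<close> is a triple and has excess at most 0.\<close>
    case True
    define M where "M = N - {v}"
    have M: "N = insert v M" "v \<notin> M" "M \<subseteq> W" "finite M"
      using True N fin finite_subset[of N "insert v W"] by (auto simp: M_def)
    have cN: "card N = Suc (card M)" using M by simp
    show ?thesis
    proof (cases "3 \<le> card M")
      case True
      have "card (nbrs E v M) \<le> s + 3"
        unfolding s[symmetric] by (rule card_mono[OF finN]) (use M in \<open>auto simp: nbrs_def\<close>)
      then show ?thesis
        using mono[OF M(3) True] cN M by (simp add: excess_def edge_count_insert)
    next
      case False
      then show ?thesis using excess_card_3[of N E] N cN by simp
    qed
  qed
  moreover have "edge_count E (nbrs E v W) + phi q \<le> 3 + 2 * s + phi (q + s)"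
  proof -
    have "int (edge_count E (nbrs E v W)) \<le> int q + 3 * int s + 3"
      using mono[OF subN] s by (simp add: excess_def)
    then have "edge_count E (nbrs E v W) \<le> q + 3 * s + 3" by linarith
    moreover have "edge_count E (nbrs E v W) \<le> (Suc s choose 2) + 2 * s + 3"
      using edge_count_le[OF finN, of E] s
      by (simp add: numeral_3_eq_3 choose_2_Suc[of "Suc s"] choose_2_Suc[of "Suc (Suc s)"])
    ultimately show ?thesis
      using phi_increment_large[of s q] phi_increment_small[of q s]
      by (cases "(s choose 2) \<le> q") auto
  qed
  ultimately show ?thesis
    using tri triangle_count_insert_le[OF fin v, of E] fin v ex W
    unfolding rigid_like_def ex nat_int by auto
qed

section \<open>Graphs of the 2-dimensional PS spheres\<close>

text \<open>The start of the vertex insertions: the excess is 0, and the single triangle meets the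
  bound 3 * 3 - 8.\<close>

lemma rigid_like_triangle:
  assumes "card {a, b, c} = 3" "{a, b} \<in> E" "{a, c} \<in> E" "{b, c} \<in> E"
  shows "rigid_like E {a, b, c}"
proof -
  have d: "a \<noteq> b" "a \<noteq> c" "b \<noteq> c" using assms(1) by (auto simp: card_insert_if split: if_splits)
  have "{{a, b}, {a, c}, {b, c}} \<subseteq> {F \<in> E. card F = 2 \<and> F \<subseteq> {a, b, c}}" using assms(2-4) d by auto
  moreover have "card {{a, b}, {a, c}, {b, c}} = 3" using d by (auto simp: doubleton_eq_iff)
  ultimately have "3 \<le> edge_count E {a, b, c}"
    unfolding edge_count_def
    using card_mono[of "{F \<in> E. card F = 2 \<and> F \<subseteq> {a, b, c}}" "{{a, b}, {a, c}, {b, c}}"] by simp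
  then have ex: "excess E {a, b, c} = 0" using assms(1) excess_card_3[of "{a, b, c}" E] by (simp add: excess_def)
  have sub: "N = {a, b, c}" if "N \<subseteq> {a, b, c}" "3 \<le> card N" for N
    by (rule card_seteq) (use that assms(1) in simp_all)
  have "triangle_count E {a, b, c} \<le> card {{a, b, c}}"
    unfolding triangle_count_def by (intro card_mono subsetI) (simp_all add: sub)
  moreover have "excess E N \<le> excess E {a, b, c}" if "N \<subseteq> {a, b, c}" "3 \<le> card N" for N
    using sub[OF that] by simp
  ultimately show ?thesis unfolding rigid_like_def using ex assms(1) by simp
qed

lemma rigid_like_insert_subset:
  assumes "rigid_like E W" "v \<notin> W" "S \<subseteq> W" "3 \<le> card S" "\<And>u. u \<in> S \<Longrightarrow> {u, v} \<in> E"
  shows "rigid_like E (insert v W)"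
proof (rule rigid_like_insert[OF assms(1,2)])
  have "finite (nbrs E v W)" using assms(1) by (simp add: rigid_like_def nbrs_def)
  moreover have "S \<subseteq> nbrs E v W" using assms(3,5) by (auto simp: nbrs_def)
  ultimately show "3 \<le> card (nbrs E v W)" using assms(4) card_mono le_trans by blast
qed

lemma edge_count_missing:
  assumes "finite N" "M \<subseteq> N" "card M = 2" "M \<notin> E"
  shows "Suc (edge_count E N) \<le> (card N choose 2)"
proof -
  have "{F \<in> E. card F = 2 \<and> F \<subseteq> N} \<subset> {F. F \<subseteq> N \<and> card F = 2}"
    using assms(2-4) by blast
  then have "edge_count E N < card {F. F \<subseteq> N \<and> card F = 2}"
    unfolding edge_count_def using assms(1) by (intro psubset_card_mono) auto
  then show ?thesis using n_subsets[OF assms(1), of 2] by simp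
qed

lemma rigid_like_complete4:
  assumes W: "card W = 4" and E: "\<And>u v. u \<in> W \<Longrightarrow> v \<in> W \<Longrightarrow> u \<noteq> v \<Longrightarrow> {u, v} \<in> E"
  shows "rigid_like E W"
proof -
  obtain a W' where a: "W = insert a W'" "a \<notin> W'" "card W' = 3"
    using W card_eq_SucD[of W 3] by auto
  then obtain b c d where W': "W' = {b, c, d}" by (auto simp: card_3_iff)
  have d: "b \<noteq> c" "b \<noteq> d" "c \<noteq> d" using a(3) W' by (auto simp: card_insert_if split: if_splits)
  have "rigid_like E {b, c, d}"
    by (rule rigid_like_triangle) (use a W' d E in auto)
  then show ?thesis
    unfolding a(1) W' by (rule rigid_like_insert_subset[where S = "{b, c, d}"]) (use a W' E in auto)
qed

lemma rigid_like_bipyramid: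
  assumes W: "card T = 3" "x \<notin> T" "y \<notin> T" "x \<noteq> y"
    and E: "\<And>u v. u \<in> T \<Longrightarrow> v \<in> insert x (insert y T) \<Longrightarrow> u \<noteq> v \<Longrightarrow> {u, v} \<in> E"
  shows "rigid_like E (insert x (insert y T))"
proof -
  have "finite T" using W(1) card_ge_0_finite by force
  then have "card (insert y T) = 4" using W by simp
  moreover have "{u, v} \<in> E" if "u \<in> insert y T" "v \<in> insert y T" "u \<noteq> v" for u v
    using that E[of u v] E[of v u] by (auto simp: insert_commute)
  ultimately have "rigid_like E (insert y T)" by (rule rigid_like_complete4)
  then show ?thesis
    by (rule rigid_like_insert_subset[where S = T]) (use W E in auto)
qed

text \<open>The diagonal from a to x provides an insertion order with three earlier neighbours each:
  x after a, b, c, then y next to a, x, c, and z next to a, x, b.\<close>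

lemma rigid_like_octahedron_diagonal:
  assumes d: "distinct [a, x, b, y, c, z]"
    and E: "\<And>u v. u \<in> {a, x, b, y, c, z} \<Longrightarrow> v \<in> {a, x, b, y, c, z} \<Longrightarrow> u \<noteq> v \<Longrightarrow>
      {u, v} \<noteq> {b, y} \<Longrightarrow> {u, v} \<noteq> {c, z} \<Longrightarrow> {u, v} \<in> E"
  shows "rigid_like E {a, x, b, y, c, z}"
proof -
  have ne: "a \<noteq> x" "a \<noteq> b" "a \<noteq> y" "a \<noteq> c" "a \<noteq> z" "x \<noteq> b" "x \<noteq> y" "x \<noteq> c" "x \<noteq> z"
    "b \<noteq> y" "b \<noteq> c" "b \<noteq> z" "y \<noteq> c" "y \<noteq> z" "c \<noteq> z"
    using d by simp_all
  note ne = ne ne[symmetric]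
  have e: "{a, b} \<in> E" "{a, c} \<in> E" "{b, c} \<in> E" "{a, x} \<in> E" "{b, x} \<in> E" "{c, x} \<in> E"
    "{a, y} \<in> E" "{x, y} \<in> E" "{c, y} \<in> E" "{a, z} \<in> E" "{x, z} \<in> E" "{b, z} \<in> E"
    by (rule E; simp add: doubleton_eq_iff ne)+
  have "rigid_like E {a, b, c}"
    by (rule rigid_like_triangle) (simp_all add: ne e)
  then have "rigid_like E (insert x {a, b, c})"
    by (rule rigid_like_insert_subset[where S = "{a, b, c}"]) (use e in \<open>auto simp: ne\<close>)
  then have "rigid_like E (insert y (insert x {a, b, c}))"
    by (rule rigid_like_insert_subset[where S = "{a, x, c}"]) (use e in \<open>auto simp: ne\<close>)
  then have "rigid_like E (insert z (insert y (insert x {a, b, c})))"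
    by (rule rigid_like_insert_subset[where S = "{a, x, b}"]) (use e in \<open>auto simp: ne\<close>)
  moreover have "insert z (insert y (insert x {a, b, c})) = {a, x, b, y, c, z}" by auto
  ultimately show ?thesis by simp
qed

text \<open>A vertex outside a triangle of the octahedral graph is adjacent to just two of its
  vertices, so insertion cannot start and \<open>rigid_like\<close> is verified directly. There are
  12 = 3 * 6 - 6 edges, hence excess 0, and the triangle bound is 10 = 3 * 6 - 8.\<close>

lemma rigid_like_octahedron_no_diagonal:
  assumes d: "distinct [a, x, b, y, c, z]"
    and E: "\<And>u v. u \<in> {a, x, b, y, c, z} \<Longrightarrow> v \<in> {a, x, b, y, c, z} \<Longrightarrow> u \<noteq> v \<Longrightarrow>
      {u, v} \<in> E \<longleftrightarrow> {u, v} \<notin> {{a, x}, {b, y}, {c, z}}"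
  shows "rigid_like E {a, x, b, y, c, z}"
proof -
  define W where "W = {a, x, b, y, c, z}"
  define D where "D = {{a, x}, {b, y}, {c, z}}"
  have ne: "a \<noteq> x" "a \<noteq> b" "a \<noteq> y" "a \<noteq> c" "a \<noteq> z" "x \<noteq> b" "x \<noteq> y" "x \<noteq> c" "x \<noteq> z"
    "b \<noteq> y" "b \<noteq> c" "b \<noteq> z" "y \<noteq> c" "y \<noteq> z" "c \<noteq> z"
    using d by simp_all
  note ne = ne ne[symmetric]
  have non: "{a, x} \<notin> E" "{b, y} \<notin> E" "{c, z} \<notin> E"
    by (subst E; simp add: ne)+
  have edge: "{b, x} \<in> E" "{y, x} \<in> E" "{c, x} \<in> E" "{z, x} \<in> E"
    "{b, a} \<in> E" "{y, a} \<in> E" "{c, a} \<in> E" "{z, a} \<in> E"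
    "{c, y} \<in> E" "{z, y} \<in> E" "{c, b} \<in> E" "{z, b} \<in> E"
    by (subst E; simp add: doubleton_eq_iff ne)+
  have fin: "finite W" and cW: "card W = 6" by (simp_all add: W_def ne)
  have cD: "card D = 3" by (simp add: D_def doubleton_eq_iff ne)
  have D: "finite D" "\<And>M. M \<in> D \<Longrightarrow> M \<subseteq> W \<and> card M = 2 \<and> M \<notin> E"
    using non by (auto simp: D_def W_def ne)
  have "{F \<in> E. card F = 2 \<and> F \<subseteq> W} = {F. F \<subseteq> W \<and> card F = 2} - D"
  proof (intro equalityI subsetI)
    fix F assume F: "F \<in> {F. F \<subseteq> W \<and> card F = 2} - D"
    then obtain u v where "F = {u, v}" "u \<noteq> v" by (auto simp: card_2_iff)
    moreover from this F have "u \<in> W" "v \<in> W" "{u, v} \<notin> D" by auto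
    ultimately show "F \<in> {F \<in> E. card F = 2 \<and> F \<subseteq> W}" using F E[of u v] by (simp add: W_def D_def)
  qed (use D(2) in blast)
  moreover have "card {F. F \<subseteq> W \<and> card F = 2} = 15"
    using n_subsets[OF fin, of 2] cW by (simp add: eval_nat_numeral)
  moreover have "D \<subseteq> {F. F \<subseteq> W \<and> card F = 2}" using D(2) by blast
  ultimately have "edge_count E W = 12"
    using D(1) cD by (simp add: edge_count_def card_Diff_subset)
  then have ex: "excess E W = 0" using cW by (simp add: excess_def)
  have "excess E N \<le> 0" if N: "N \<subseteq> W" "3 \<le> card N" for N
  proof -
    have finN: "finite N" using N fin finite_subset by blast
    have "card N \<le> 6" using card_mono[OF fin N(1)] cW by simp
    then consider "card N = 3" | "card N = 4" | "card N = 5" | "card N = 6" using N(2) by linarith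
    then show ?thesis
    proof cases
      case 1
      then show ?thesis by (rule excess_card_3)
    next
      case 2
      then show ?thesis using edge_count_le[OF finN, of E] by (simp add: excess_def eval_nat_numeral)
    next
      case 3
      then have "card (W - N) = 1" using card_Diff_subset[OF finN N(1)] cW by simp
      then obtain w where w: "W - N = {w}" by (auto simp: card_1_singleton_iff)
      \<comment> \<open>The missing vertex lies in only one antipodal pair. Another pair stays in
        \<open>N\<close> as a non-edge, which leaves at most 9 = 3 * 5 - 6 edges.\<close>
      have "w \<notin> {a, x} \<or> w \<notin> {b, y}" using ne by blast
      then obtain M where M: "M \<in> D" "w \<notin> M" unfolding D_def by blast
      have "M \<subseteq> W" "card M = 2" "M \<notin> E" using D(2)[OF M(1)] by simp_all
      moreover from this(1) have "M \<subseteq> N" using M(2) w by (metis DiffI singletonD subset_iff)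
      ultimately have "Suc (edge_count E N) \<le> (card N choose 2)"
        using edge_count_missing[OF finN] by blast
      then show ?thesis using 3 by (simp add: excess_def eval_nat_numeral)
    next
      case 4
      then have "N = W" using card_seteq[OF fin N(1)] cW by simp
      then show ?thesis using ex by simp
    qed
  qed
  moreover have "triangle_count E W \<le> 10"
  proof -
    \<comment> \<open>The 4-cycle has 4 edges, but the cruder bound 5, used for both a and x,
      already gives 10.\<close>
    have e4: "edge_count E {b, y, c, z} \<le> 5"
      using edge_count_missing[of "{b, y, c, z}" "{b, y}" E] non
      by (simp add: ne eval_nat_numeral)
    have e2: "edge_count E {c, z} = 0"
      using edge_count_missing[of "{c, z}" "{c, z}" E] non
      by (simp add: ne eval_nat_numeral)
    have nb: "nbrs E x {b, y, c, z} = {b, y, c, z}" "nbrs E a {x, b, y, c, z} = {b, y, c, z}"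
      "nbrs E y {c, z} = {c, z}" "nbrs E b {y, c, z} = {c, z}"
      using edge non by (auto simp: nbrs_def insert_commute)
    have "card F \<noteq> 3" if "F \<subseteq> {c, z}" for F
      using card_mono[OF _ that] by (simp add: ne)
    then have "{F. F \<subseteq> {c, z} \<and> card F = 3 \<and> (\<forall>G. G \<subseteq> F \<longrightarrow> card G = 2 \<longrightarrow> G \<in> E)} = {}"
      by blast
    then have "triangle_count E {c, z} = 0" by (simp only: triangle_count_def card.empty)
    then have "triangle_count E {b, y, c, z} = 0"
      using triangle_count_insert_le[of "{c, z}" y E] triangle_count_insert_le[of "{y, c, z}" b E]
        e2 nb by (simp add: ne)
    then show ?thesis
      using triangle_count_insert_le[of "{b, y, c, z}" x E]
        triangle_count_insert_le[of "{x, b, y, c, z}" a E] e4 nb by (simp add: W_def ne)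
  qed
  ultimately have "rigid_like E W" using fin cW ex by (simp add: rigid_like_def)
  then show ?thesis by (simp add: W_def)
qed

text \<open>\<open>E\<close> will be the whole complex, where later ears may have supplied diagonals
  of the octahedron. Any one of them allows vertex insertion, and if there is none, the induced
  graph is exactly the octahedral one.\<close>

lemma rigid_like_octahedron:
  assumes d: "distinct [a, x, b, y, c, z]"
    and E: "\<And>u v. u \<in> {a, x, b, y, c, z} \<Longrightarrow> v \<in> {a, x, b, y, c, z} \<Longrightarrow> u \<noteq> v \<Longrightarrow>
      {u, v} \<notin> {{a, x}, {b, y}, {c, z}} \<Longrightarrow> {u, v} \<in> E"
  shows "rigid_like E {a, x, b, y, c, z}"
proof -
  consider "{a, x} \<in> E" | "{b, y} \<in> E" | "{c, z} \<in> E" | "{a, x} \<notin> E" "{b, y} \<notin> E" "{c, z} \<notin> E"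
    by blast
  then show ?thesis
  proof cases
    case 1
    show ?thesis
    proof (rule rigid_like_octahedron_diagonal[OF d])
      show "{u, v} \<in> E" if "u \<in> {a, x, b, y, c, z}" "v \<in> {a, x, b, y, c, z}" "u \<noteq> v"
        "{u, v} \<noteq> {b, y}" "{u, v} \<noteq> {c, z}" for u v
        using E[OF that(1-3)] that(4,5) 1 by (cases "{u, v} = {a, x}") simp_all
    qed
  next
    case 2
    have perm: "{b, y, a, x, c, z} = {a, x, b, y, c, z}" by blast
    have "rigid_like E {b, y, a, x, c, z}"
    proof (rule rigid_like_octahedron_diagonal)
      show "distinct [b, y, a, x, c, z]" using d by auto
      show "{u, v} \<in> E" if "u \<in> {b, y, a, x, c, z}" "v \<in> {b, y, a, x, c, z}" "u \<noteq> v"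
        "{u, v} \<noteq> {a, x}" "{u, v} \<noteq> {c, z}" for u v
        using E[OF that(1-3)[unfolded perm]] that(4,5) 2 by (cases "{u, v} = {b, y}") simp_all
    qed
    then show ?thesis by (simp only: perm)
  next
    case 3
    have perm: "{c, z, a, x, b, y} = {a, x, b, y, c, z}" by blast
    have "rigid_like E {c, z, a, x, b, y}"
    proof (rule rigid_like_octahedron_diagonal)
      show "distinct [c, z, a, x, b, y]" using d by auto
      show "{u, v} \<in> E" if "u \<in> {c, z, a, x, b, y}" "v \<in> {c, z, a, x, b, y}" "u \<noteq> v"
        "{u, v} \<noteq> {a, x}" "{u, v} \<noteq> {b, y}" for u v
        using E[OF that(1-3)[unfolded perm]] that(4,5) 3 by (cases "{u, v} = {c, z}") simp_all
    qed
    then show ?thesis by (simp only: perm)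
  next
    case 4
    show ?thesis
    proof (rule rigid_like_octahedron_no_diagonal[OF d])
      show "{u, v} \<in> E \<longleftrightarrow> {u, v} \<notin> {{a, x}, {b, y}, {c, z}}"
        if "u \<in> {a, x, b, y, c, z}" "v \<in> {a, x, b, y, c, z}" "u \<noteq> v" for u v
      proof
        assume "{u, v} \<in> E"
        then have "{u, v} \<noteq> {a, x}" "{u, v} \<noteq> {b, y}" "{u, v} \<noteq> {c, z}" using 4 by metis+
        then show "{u, v} \<notin> {{a, x}, {b, y}, {c, z}}" by simp
      qed (rule E[OF that])
    qed
  qed
qed

section \<open>PS spheres of low dimension\<close>

text \<open>The index is the size of a face and not its dimension, since sizes add under
  joins.\<close>

definition face_count :: "'a set set \<Rightarrow> nat \<Rightarrow> nat" where
  "face_count K k = card {F \<in> K. card F = k}"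

definition verts :: "'a set set \<Rightarrow> 'a set" where
  "verts K = {v. {v} \<in> K}"

lemma face_count_1: "face_count K 1 = card (verts K)"
proof -
  have "{F \<in> K. card F = 1} = (\<lambda>v. {v}) ` verts K"
    by (auto simp: verts_def card_1_singleton_iff)
  then show ?thesis by (simp add: face_count_def card_image)
qed

lemma asc_join_commute: "asc_join K L = asc_join L K"
  unfolding asc_join_def by (auto; metis Un_commute)

lemma asc_join_unit: "asc_join {{}} K = K" "asc_join K {{}} = K"
  unfolding asc_join_def by auto

lemma asc_joinI: "F \<in> K \<Longrightarrow> G \<in> L \<Longrightarrow> F \<union> G \<in> asc_join K L"
  unfolding asc_join_def by blast

lemma asc_joinE:
  assumes "F \<in> asc_join K L"
  obtains A B where "F = A \<union> B" "A \<in> K" "B \<in> L"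
  using assms unfolding asc_join_def by blast

lemma asc_join_superset:
  "{} \<in> K \<Longrightarrow> L \<subseteq> asc_join K L" "{} \<in> L \<Longrightarrow> K \<subseteq> asc_join K L"
  unfolding asc_join_def by blast+

lemma empty_in_simplex_bd: "A \<noteq> {} \<Longrightarrow> {} \<in> simplex_bd A"
  by (auto simp: simplex_bd_def)

lemma Union_simplex_bd:
  assumes "2 \<le> card A"
  shows "\<Union>(simplex_bd A) = A"
proof -
  have "{a} \<in> simplex_bd A" if "a \<in> A" for a using that assms by (auto simp: simplex_bd_def)
  then show ?thesis by (auto simp: simplex_bd_def)
qed

lemma Union_asc_join: "{} \<in> K \<Longrightarrow> {} \<in> L \<Longrightarrow> \<Union>(asc_join K L) = \<Union>K \<union> \<Union>L"
  by (rule equalityI, blast elim: asc_joinE)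
    (use asc_join_superset(1)[of K L] asc_join_superset(2)[of L K] in blast)

lemma verts_asc_join:
  assumes "{} \<in> K" "{} \<in> L"
  shows "verts (asc_join K L) = verts K \<union> verts L"
proof -
  have "{v} \<in> K \<or> {v} \<in> L" if v: "{v} \<in> asc_join K L" for v
  proof -
    obtain A B where AB: "{v} = A \<union> B" "A \<in> K" "B \<in> L" using v by (rule asc_joinE)
    then have "A = {v} \<or> B = {v}" by blast
    then show ?thesis using AB by auto
  qed
  then show ?thesis using asc_join_superset(1)[of K L] asc_join_superset(2)[of L K] assms
    by (auto simp: verts_def)
qed

lemma verts_simplex_bd: "2 \<le> card A \<Longrightarrow> verts (simplex_bd A) = A"
  by (auto simp: verts_def simplex_bd_def)

definition is_simplex_bd :: "nat \<Rightarrow> 'a set set \<Rightarrow> bool" where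
  "is_simplex_bd k S \<longleftrightarrow> (\<exists>A. card A = k \<and> S = simplex_bd A)"

text \<open>The base is described by a predicate so that suspensions can be nested.\<close>

definition is_suspension :: "('a set set \<Rightarrow> bool) \<Rightarrow> 'a set set \<Rightarrow> bool" where
  "is_suspension P S \<longleftrightarrow> (\<exists>x y L. x \<noteq> y \<and> x \<notin> \<Union>L \<and> y \<notin> \<Union>L \<and> P L \<and> S = asc_join (simplex_bd {x, y}) L)"

text \<open>Here \<open>n\<close> is the size of the facets, one more than the dimension.\<close>

definition low_sphere :: "nat \<Rightarrow> 'a set set \<Rightarrow> bool" where
  "low_sphere n S \<longleftrightarrow>
     (n = 0 \<longrightarrow> S = {{}}) \<and>
     (n = 1 \<longrightarrow> is_simplex_bd 2 S) \<and>
     (n = 2 \<longrightarrow> is_simplex_bd 3 S \<or> is_suspension (is_simplex_bd 2) S) \<and>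
     (n = 3 \<longrightarrow> is_simplex_bd 4 S \<or> is_suspension (is_simplex_bd 3) S
       \<or> is_suspension (is_suspension (is_simplex_bd 2)) S)"

lemma low_sphere_suspension:
  assumes S: "low_sphere n S" and x: "x \<noteq> y" "x \<notin> \<Union>S" "y \<notin> \<Union>S"
  shows "low_sphere (Suc n) (asc_join (simplex_bd {x, y}) S)"
proof -
  have susp: "is_suspension P (asc_join (simplex_bd {x, y}) S)" if "P S" for P
    unfolding is_suspension_def using x that by blast
  have "card {x, y} = 2" using x by simp
  then have s2: "is_simplex_bd 2 (simplex_bd {x, y})" unfolding is_simplex_bd_def by blast
  consider "n = 0" | "n = 1" | "n = 2" | "3 \<le> n" by linarith
  then show ?thesis
  proof cases
    case 1
    then have "S = {{}}" using S by (simp add: low_sphere_def)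
    then show ?thesis using 1 s2 by (simp add: low_sphere_def asc_join_unit)
  next
    case 2
    then show ?thesis using S susp by (simp add: low_sphere_def)
  next
    case 3
    then have "is_simplex_bd 3 S \<or> is_suspension (is_simplex_bd 2) S" using S by (simp add: low_sphere_def)
    then show ?thesis using 3 susp by (auto simp: low_sphere_def)
  next
    case 4
    then show ?thesis by (simp add: low_sphere_def)
  qed
qed

text \<open>Facet sizes add, with card V - 1 from the simplex boundary. A one-element
  \<open>V\<close> changes nothing, and a pair gives a suspension. For a larger \<open>V\<close> and
  total size at most 3, either \<open>S\<close> is trivial, or \<open>V\<close> is a triple and
  \<open>S\<close> consists of two points; exchanging the factors then makes the join a
  suspension.\<close>

lemma low_sphere_join:
  fixes S :: "'a set set"
  assumes S: "low_sphere n S" and V: "finite V" "V \<noteq> {}" "V \<inter> \<Union>S = {}"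
  shows "low_sphere (card V - 1 + n) (asc_join (simplex_bd V) S)"
proof -
  have "0 < card V" using V by (simp add: card_gt_0_iff)
  then consider "card V = 1" | "card V = 2" | "3 \<le> card V" by linarith
  then show ?thesis
  proof cases
    case 1
    then obtain v where "V = {v}" by (auto simp: card_1_singleton_iff)
    then have "simplex_bd V = {{}}" by (auto simp: simplex_bd_def)
    then show ?thesis using 1 S by (simp add: asc_join_unit)
  next
    case 2
    then obtain x y where "V = {x, y}" "x \<noteq> y" by (auto simp: card_2_iff)
    then show ?thesis using low_sphere_suspension[OF S, of x y] V by simp
  next
    case 3
    consider "n = 0" | "card V = 3" "n = 1" | "4 \<le> card V - 1 + n" using 3 by linarith
    then show ?thesis
    proof cases
      case 1
      then have eq: "asc_join (simplex_bd V) S = simplex_bd V"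
        using S by (simp add: low_sphere_def asc_join_unit)
      have "is_simplex_bd (card V) (simplex_bd V)" unfolding is_simplex_bd_def by blast
      then have "is_simplex_bd 3 (simplex_bd V)" if "card V = 3" using that by simp
      moreover have "is_simplex_bd 4 (simplex_bd V)" if "card V = 4"
        using that \<open>is_simplex_bd (card V) (simplex_bd V)\<close> by simp
      moreover obtain m where "card V = Suc m" using 3 by (cases "card V") simp_all
      ultimately show ?thesis unfolding eq low_sphere_def using 1 3 by auto
    next
      case 2
      then obtain A where A: "card A = 2" "S = simplex_bd A" using S by (auto simp: low_sphere_def is_simplex_bd_def)
      then obtain x y where xy: "A = {x, y}" "x \<noteq> y" by (auto simp: card_2_iff)
      have "x \<notin> V" "y \<notin> V" using V(3) Union_simplex_bd[of A] A xy by auto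
      moreover have "\<Union>(simplex_bd V) = V" using 3 by (intro Union_simplex_bd) simp
      moreover have "is_simplex_bd 3 (simplex_bd V)" using 2 by (auto simp: is_simplex_bd_def)
      moreover have "asc_join (simplex_bd V) S = asc_join (simplex_bd {x, y}) (simplex_bd V)"
        unfolding A xy by (rule asc_join_commute)
      ultimately have "is_suspension (is_simplex_bd 3) (asc_join (simplex_bd V) S)"
        unfolding is_suspension_def using xy(2) by metis
      then show ?thesis using 2 by (simp add: low_sphere_def)
    next
      case 3
      \<comment> \<open>Above facet size 3 \<open>low_sphere\<close> imposes no condition.\<close>
      have "low_sphere m L" if "4 \<le> m" for m :: nat and L :: "'a set set"
        using that by (simp add: low_sphere_def)
      then show ?thesis using 3 .
    qed
  qed
qed

lemma ps_sphere_low_sphere: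
  assumes "ps_sphere S"
  shows "\<exists>n. (\<forall>F\<in>S. card F \<le> n) \<and> (\<exists>F\<in>S. card F = n) \<and> low_sphere n S"
  using assms
proof induction
  case empty
  show ?case by (rule exI[of _ 0]) (simp add: low_sphere_def)
next
  case (join V S)
  then obtain n where n: "\<forall>F\<in>S. card F \<le> n" "\<exists>F\<in>S. card F = n" "low_sphere n S" by blast
  have finS: "finite F" if "F \<in> S" for F
    using ps_sphere_structure[OF join.hyps(3)] that by (auto simp: asc_def)
  have cU: "card (A \<union> B) = card A + card B" if "A \<subseteq> V" "B \<in> S" for A B
    using that finS[OF that(2)] join.hyps finite_subset[OF that(1)] by (intro card_Un_disjoint) auto
  show ?case
  proof (intro exI[of _ "card V - 1 + n"] conjI ballI)
    fix F assume "F \<in> asc_join (simplex_bd V) S"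
    then obtain A B where F: "F = A \<union> B" "A \<in> simplex_bd V" "B \<in> S" by (rule asc_joinE)
    then have A: "A \<subset> V" by (auto simp: simplex_bd_def)
    then have "card A < card V" using join.hyps(1) by (rule psubset_card_mono[rotated])
    then show "card F \<le> card V - 1 + n" using F cU[of A B] A n(1) by fastforce
  next
    obtain v where v: "v \<in> V" using join.hyps by blast
    obtain H where H: "H \<in> S" "card H = n" using n(2) by blast
    have "V - {v} \<union> H \<in> asc_join (simplex_bd V) S"
      using v H by (intro asc_joinI) (auto simp: simplex_bd_def)
    moreover have "card (V - {v} \<union> H) = card V - 1 + n" using cU[of "V - {v}" H] v H by auto
    ultimately show "\<exists>F\<in>asc_join (simplex_bd V) S. card F = card V - 1 + n" by blast
  next
    show "low_sphere (card V - 1 + n) (asc_join (simplex_bd V) S)"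
      using low_sphere_join[OF n(3)] join.hyps by blast
  qed
qed

section \<open>Face numbers of simplex boundaries and suspensions\<close>

lemma face_count_simplex_bd:
  assumes "k < card A"
  shows "face_count (simplex_bd A) k = (card A choose k)"
proof -
  have "{F \<in> simplex_bd A. card F = k} = {F. F \<subseteq> A \<and> card F = k}"
    using assms by (auto simp: simplex_bd_def)
  then show ?thesis using n_subsets[of A k] assms card_ge_0_finite[of A] by (simp add: face_count_def)
qed

lemma face_count_simplex_bd_top:
  assumes "card A = Suc k"
  shows "face_count (simplex_bd A) (Suc k) = 0"
proof -
  have "finite A" using assms card_ge_0_finite by force
  then have "{F \<in> simplex_bd A. card F = Suc k} = {}"
    using assms by (auto simp: simplex_bd_def dest: card_subset_eq)
  then show ?thesis by (simp only: face_count_def card.empty)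
qed

lemma asc_join_UN: "asc_join K L = (\<Union>F\<in>K. (\<lambda>G. F \<union> G) ` L)"
  unfolding asc_join_def by blast

text \<open>A face contains at most one of the two apexes, and deleting the apex leaves a face of
  \<open>L\<close>.\<close>

lemma face_count_suspension:
  assumes xy: "x \<noteq> y" "x \<notin> \<Union>L" "y \<notin> \<Union>L" and L: "finite (\<Union>L)"
  shows "face_count (asc_join (simplex_bd {x, y}) L) (Suc k) = face_count L (Suc k) + 2 * face_count L k"
proof -
  have finL: "finite L" using L by (rule finite_UnionD)
  have notin: "x \<notin> F" "y \<notin> F" if "F \<in> L" for F using xy that by auto
  have cardI: "card (insert x F) = Suc (card F)" "card (insert y F) = Suc (card F)" if "F \<in> L" for F
    using notin[OF that] finite_subset[OF Union_upper[OF that] L] by simp_all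
  have bd: "simplex_bd {x, y} = {{}, {x}, {y}}" using xy by (auto simp: simplex_bd_def)
  have J: "asc_join (simplex_bd {x, y}) L = L \<union> (insert x ` L \<union> insert y ` L)"
    by (simp add: asc_join_UN bd Un_assoc)
  let ?L = "\<lambda>k. {F \<in> L. card F = k}"
  have "{F \<in> insert x ` L. card F = Suc k} = insert x ` ?L k"
    "{F \<in> insert y ` L. card F = Suc k} = insert y ` ?L k"
    using cardI by (intro equalityI subsetI; elim CollectE conjE imageE; simp)+
  moreover have "{F \<in> A \<union> (B \<union> C). P F} = {F \<in> A. P F} \<union> ({F \<in> B. P F} \<union> {F \<in> C. P F})"
    for A B C :: "'a set set" and P by blast
  ultimately have "{F \<in> asc_join (simplex_bd {x, y}) L. card F = Suc k} =
      ?L (Suc k) \<union> (insert x ` ?L k \<union> insert y ` ?L k)"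
    by (simp only: J)
  moreover have "?L (Suc k) \<inter> (insert x ` ?L k \<union> insert y ` ?L k) = {}"
    using notin by blast
  moreover have "insert x ` ?L k \<inter> insert y ` ?L k = {}"
  proof -
    have "insert x F \<noteq> insert y G" if "F \<in> L" "G \<in> L" for F G
      using notin(1)[OF that(2)] xy(1) by (metis insertI1 insertE)
    then show ?thesis by blast
  qed
  moreover have "card (insert x ` ?L k) = card (?L k)" "card (insert y ` ?L k) = card (?L k)"
    by (rule card_image, rule inj_onI, metis (no_types, lifting) notin Diff_insert_absorb mem_Collect_eq)+
  ultimately show ?thesis using finL by (simp add: face_count_def card_Un_disjoint)
qed

lemma face_count_0: "{} \<in> K \<Longrightarrow> (\<And>F. F \<in> K \<Longrightarrow> finite F) \<Longrightarrow> face_count K 0 = 1"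
proof -
  assume K: "{} \<in> K" "\<And>F. F \<in> K \<Longrightarrow> finite F"
  then have "{F \<in> K. card F = 0} = {{}}" by auto
  then show ?thesis by (simp add: face_count_def)
qed

lemma is_simplex_bd_counts:
  assumes "is_simplex_bd (Suc (Suc k)) S"
  shows "finite (\<Union>S)" "{} \<in> S" "\<And>j. j \<le> Suc k \<Longrightarrow> face_count S j = (Suc (Suc k) choose j)"
    "face_count S (Suc (Suc k)) = 0"
proof -
  obtain A where A: "card A = Suc (Suc k)" "S = simplex_bd A" using assms by (auto simp: is_simplex_bd_def)
  then have "finite A" "A \<noteq> {}" using card_ge_0_finite by force+
  then show "finite (\<Union>S)" "{} \<in> S" using A Union_simplex_bd[of A] empty_in_simplex_bd[of A] by auto
  show "face_count S j = (Suc (Suc k) choose j)" if "j \<le> Suc k" for j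
    using face_count_simplex_bd[of j A] A that by simp
  show "face_count S (Suc (Suc k)) = 0" using face_count_simplex_bd_top A by metis
qed

text \<open>What is demanded of \<open>P\<close> is established for the suspension too, so the lemma
  applies again to a suspension of suspensions.\<close>

lemma is_suspension_counts:
  assumes S: "is_suspension P S" and P: "\<forall>L. P L \<longrightarrow> finite (\<Union>L) \<and> {} \<in> L \<and> face_count L 0 = 1"
  shows "\<exists>L. P L \<and> finite (\<Union>S) \<and> {} \<in> S \<and> face_count S 0 = 1 \<and>
    (\<forall>k. face_count S (Suc k) = face_count L (Suc k) + 2 * face_count L k)"
proof -
  obtain x y L where L: "x \<noteq> y" "x \<notin> \<Union>L" "y \<notin> \<Union>L" "P L" "S = asc_join (simplex_bd {x, y}) L"
    using S by (auto simp: is_suspension_def)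
  have PL: "finite (\<Union>L)" "{} \<in> L" using P L(4) by blast+
  have bd: "{} \<in> simplex_bd {x, y}" "\<Union>(simplex_bd {x, y}) = {x, y}"
    using L(1) empty_in_simplex_bd[of "{x, y}"] Union_simplex_bd[of "{x, y}"] by auto
  have fin: "finite (\<Union>S)" "{} \<in> S"
    using PL bd asc_joinI[OF bd(1) PL(2)] by (simp_all add: L(5) Union_asc_join)
  then have "face_count S 0 = 1"
    using finite_UnionD finite_subset[OF Union_upper] by (intro face_count_0) blast+
  then show ?thesis using L(4) fin face_count_suspension[OF L(1-3) PL(1)] L(5) by blast
qed

lemma is_simplex_bd_augmented:
  assumes "is_simplex_bd k L" "2 \<le> k"
  shows "finite (\<Union>L) \<and> {} \<in> L \<and> face_count L 0 = 1"
proof -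
  obtain j where k: "k = Suc (Suc j)" using assms(2) by (metis add_2_eq_Suc le_Suc_ex)
  show ?thesis
    using is_simplex_bd_counts(1-2)[OF assms(1)[unfolded k]]
      is_simplex_bd_counts(3)[OF assms(1)[unfolded k], of 0] by simp
qed

lemma low_sphere_2_counts:
  fixes S :: "'a set set"
  assumes "low_sphere 2 S"
  shows "face_count S 2 = face_count S 1 \<and> (face_count S 1 = 3 \<or> face_count S 1 = 4)"
proof -
  have two: "\<forall>L :: 'a set set. is_simplex_bd 2 L \<longrightarrow> finite (\<Union>L) \<and> {} \<in> L \<and> face_count L 0 = 1"
    by (simp add: is_simplex_bd_augmented)
  consider "is_simplex_bd 3 S" | "is_suspension (is_simplex_bd 2) S"
    using assms by (auto simp: low_sphere_def)
  then show ?thesis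
  proof cases
    case 1
    then show ?thesis using is_simplex_bd_counts(3)[of 1 S] by (simp add: eval_nat_numeral)
  next
    case 2
    obtain L :: "'a set set" where L: "is_simplex_bd 2 L"
      "\<forall>k. face_count S (Suc k) = face_count L (Suc k) + 2 * face_count L k"
      using is_suspension_counts[OF 2 two] by blast
    show ?thesis using L(1) L(2)[rule_format, of 0] L(2)[rule_format, of 1] is_simplex_bd_counts(3,4)[of 0 L]
      by (simp add: eval_nat_numeral)
  qed
qed

text \<open>The triples belong to the tetrahedron boundary, the bipyramid over a triangle and the
  octahedron.\<close>

lemma low_sphere_3_counts:
  fixes S :: "'a set set"
  assumes "low_sphere 3 S"
  shows "(face_count S 1, face_count S 2, face_count S 3) \<in> {(4, 6, 4), (5, 9, 6), (6, 12, 8)}"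
proof -
  have two: "\<forall>L :: 'a set set. is_simplex_bd 2 L \<longrightarrow> finite (\<Union>L) \<and> {} \<in> L \<and> face_count L 0 = 1"
    by (simp add: is_simplex_bd_augmented)
  have three: "\<forall>L :: 'a set set. is_simplex_bd 3 L \<longrightarrow> finite (\<Union>L) \<and> {} \<in> L \<and> face_count L 0 = 1"
    by (simp add: is_simplex_bd_augmented)
  have susp: "\<forall>L :: 'a set set. is_suspension (is_simplex_bd 2) L \<longrightarrow> finite (\<Union>L) \<and> {} \<in> L \<and> face_count L 0 = 1"
    using is_suspension_counts[OF _ two] by blast
  consider "is_simplex_bd 4 S" | "is_suspension (is_simplex_bd 3) S"
    | "is_suspension (is_suspension (is_simplex_bd 2)) S"
    using assms by (auto simp: low_sphere_def)
  then show ?thesis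
  proof cases
    case 1
    then show ?thesis using is_simplex_bd_counts(3)[of 2 S] by (simp add: eval_nat_numeral)
  next
    case 2
    obtain L :: "'a set set" where L: "is_simplex_bd 3 L"
      "\<forall>k. face_count S (Suc k) = face_count L (Suc k) + 2 * face_count L k"
      using is_suspension_counts[OF 2 three] by blast
    have "face_count L 0 = 1" "face_count L 1 = 3" "face_count L 2 = 3" "face_count L 3 = 0"
      using L(1) is_simplex_bd_counts(3,4)[of 1 L] by (simp_all add: eval_nat_numeral)
    then show ?thesis using L(2)[rule_format, of 0] L(2)[rule_format, of 1] L(2)[rule_format, of 2]
      by (simp add: eval_nat_numeral)
  next
    case 3
    obtain L :: "'a set set" where L: "is_suspension (is_simplex_bd 2) L"
        "\<forall>k. face_count S (Suc k) = face_count L (Suc k) + 2 * face_count L k"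
      using is_suspension_counts[OF 3 susp] by blast
    obtain M :: "'a set set" where M: "is_simplex_bd 2 M" "face_count L 0 = 1"
        "\<forall>k. face_count L (Suc k) = face_count M (Suc k) + 2 * face_count M k"
      using is_suspension_counts[OF L(1) two] by blast
    \<comment> \<open>The recursion for double suspensions asks for faces of size 3 in the two-point
      complex \<open>M\<close>, a size not covered by \<open>is_simplex_bd_counts\<close>.\<close>
    have "face_count M 3 = 0"
    proof -
      obtain A where A: "card A = 2" "M = simplex_bd A" using M(1) by (auto simp: is_simplex_bd_def)
      then have "card F \<noteq> 3" if "F \<in> M" for F
        using that card_mono[of A F] card_ge_0_finite[of A] by (auto simp: simplex_bd_def)
      then have "{F \<in> M. card F = 3} = {}" by blast
      then show ?thesis by (simp only: face_count_def card.empty)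
    qed
    moreover have "face_count M 0 = 1" "face_count M 1 = 2" "face_count M 2 = 0"
      using M(1) is_simplex_bd_counts(3,4)[of 0 M] by (simp_all add: eval_nat_numeral)
    ultimately show ?thesis
      using L(2)[rule_format, of 0] L(2)[rule_format, of 1] L(2)[rule_format, of 2]
        M(2) M(3)[rule_format, of 0] M(3)[rule_format, of 1] M(3)[rule_format, of 2]
      by (simp add: eval_nat_numeral)
  qed
qed

lemma low_sphere_3_rigid_like:
  assumes S: "low_sphere 3 S" and E: "S \<subseteq> E"
  shows "rigid_like E (verts S)"
proof -
  consider "is_simplex_bd 4 S" | "is_suspension (is_simplex_bd 3) S"
    | "is_suspension (is_suspension (is_simplex_bd 2)) S"
    using assms by (auto simp: low_sphere_def)
  then show ?thesis
  proof cases
    case 1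
    then obtain A where A: "card A = 4" "S = simplex_bd A" by (auto simp: is_simplex_bd_def)
    have "{u, v} \<in> S" if "u \<in> A" "v \<in> A" for u v
    proof -
      have "{u, v} \<noteq> A" using A(1) card_insert_le_m1[of 2 "{v}" u] by auto
      then show ?thesis using that A(2) by (simp add: simplex_bd_def)
    qed
    then have "rigid_like E A" using E by (intro rigid_like_complete4[OF A(1)]) blast
    then show ?thesis using A by (simp add: verts_simplex_bd)
  next
    case 2
    then obtain x y T where xy: "x \<noteq> y" and T: "x \<notin> \<Union>(simplex_bd T)" "y \<notin> \<Union>(simplex_bd T)" "card T = 3"
      and eq: "S = asc_join (simplex_bd {x, y}) (simplex_bd T)"
      by (auto simp: is_suspension_def is_simplex_bd_def)
    have T0: "T \<noteq> {}" using T(3) by auto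
    have un: "\<Union>(simplex_bd T) = T" using T(3) by (simp add: Union_simplex_bd)
    have bd: "{} \<in> simplex_bd {x, y}" "{x} \<in> simplex_bd {x, y}" "{y} \<in> simplex_bd {x, y}"
      using xy by (auto simp: simplex_bd_def)
    have "{u, v} \<in> S" if u: "u \<in> T" and v: "v \<in> insert x (insert y T)" for u v
    proof (cases "v \<in> T")
      case True
      have "{u, v} \<noteq> T" using T(3) card_insert_le_m1[of 2 "{v}" u] by auto
      then have "{u, v} \<in> simplex_bd T" using u True by (simp add: simplex_bd_def)
      then show ?thesis using asc_joinI[OF bd(1)] eq by fastforce
    next
      case False
      then have "{v} \<in> simplex_bd {x, y}" using v bd by auto
      moreover have "{u} \<in> simplex_bd T" using u T(3) by (auto simp: simplex_bd_def)
      ultimately show ?thesis using asc_joinI[of "{v}" _ "{u}"] eq by (simp add: insert_commute)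
    qed
    then have "rigid_like E (insert x (insert y T))"
      using E T un xy by (intro rigid_like_bipyramid) auto
    moreover have "verts S = insert x (insert y T)"
      using xy T(3) bd(1) empty_in_simplex_bd[of T, OF T0] by (subst eq, subst verts_asc_join) (auto simp: verts_simplex_bd)
    ultimately show ?thesis by simp
  next
    case 3
    then obtain a x b y C where ax: "a \<noteq> x" and nby: "b \<noteq> y" and C: "card C = 2"
      and dis: "a \<notin> \<Union>(asc_join (simplex_bd {b, y}) (simplex_bd C))"
        "x \<notin> \<Union>(asc_join (simplex_bd {b, y}) (simplex_bd C))"
        "b \<notin> \<Union>(simplex_bd C)" "y \<notin> \<Union>(simplex_bd C)"
      and eq: "S = asc_join (simplex_bd {a, x}) (asc_join (simplex_bd {b, y}) (simplex_bd C))"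
      by (auto simp: is_suspension_def is_simplex_bd_def)
    obtain c z where cz: "C = {c, z}" "c \<noteq> z" using C by (auto simp: card_2_iff)
    have bd: "simplex_bd {u, v} = {{}, {u}, {v}}" if "u \<noteq> v" for u v :: 'a
      using that by (auto simp: simplex_bd_def)
    have S: "S = {F \<union> (G \<union> H) | F G H. F \<in> {{}, {a}, {x}} \<and> G \<in> {{}, {b}, {y}} \<and> H \<in> {{}, {c}, {z}}}"
      unfolding eq cz bd[OF ax] bd[OF nby] bd[OF cz(2)] asc_join_def by blast
    have d: "distinct [a, x, b, y, c, z]"
      using dis ax nby cz(2) unfolding cz bd[OF nby] bd[OF cz(2)] asc_join_def by auto
    have vS: "verts S = {a, x, b, y, c, z}"
      unfolding eq by (subst verts_asc_join, simp add: bd ax, simp add: bd nby cz asc_join_def,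
        subst verts_asc_join) (auto simp: bd nby cz verts_def ax)
    have eS: "F \<union> (G \<union> H) \<in> S" if "F \<in> {{}, {a}, {x}}" "G \<in> {{}, {b}, {y}}" "H \<in> {{}, {c}, {z}}" for F G H
      using that unfolding S by blast
    have e: "{s, t} \<in> E" if "s \<in> {a, x}" "t \<in> {b, y, c, z}" for s t
      using that eS[of "{s}" "{t}" "{}"] eS[of "{s}" "{}" "{t}"] E by (auto simp: insert_commute)
    have e': "{s, t} \<in> E" if "s \<in> {b, y}" "t \<in> {c, z}" for s t
      using that eS[of "{}" "{s}" "{t}"] E by (auto simp: insert_commute)
    have "rigid_like E {a, x, b, y, c, z}"
    proof (rule rigid_like_octahedron[OF d])
      fix u v assume uv: "u \<in> {a, x, b, y, c, z}" "v \<in> {a, x, b, y, c, z}" "u \<noteq> v"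
        "{u, v} \<notin> {{a, x}, {b, y}, {c, z}}"
      then consider "u \<in> {a, x}" "v \<in> {b, y, c, z}" | "v \<in> {a, x}" "u \<in> {b, y, c, z}"
        | "u \<in> {b, y}" "v \<in> {c, z}" | "v \<in> {b, y}" "u \<in> {c, z}"
        by (auto simp: insert_commute)
      then show "{u, v} \<in> E"
        using e[of u v] e[of v u] e'[of u v] e'[of v u] by cases (simp_all add: insert_commute)
    qed
    then show ?thesis using vS by simp
  qed
qed

section \<open>Attaching ears\<close>

lemma asc_dim_eqI:
  assumes "finite K" "F \<in> K" "\<And>G. G \<in> K \<Longrightarrow> card G \<le> card F"
  shows "asc_dim K = int (card F) - 1"
  unfolding asc_dim_def using assms by (intro Max_eqI) (force simp: face_dim_def)+

lemma ps_sphere_asc: "ps_sphere S \<Longrightarrow> asc S"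
  using ps_sphere_structure by blast

lemma asc_face_count_0: "asc K \<Longrightarrow> face_count K 0 = 1"
  by (rule face_count_0) (auto simp: asc_def)

lemma ps_sphere_dim_2:
  assumes "ps_sphere S" "asc_dim S = 2"
  shows "low_sphere 3 S"
proof -
  obtain n F where n: "\<forall>F\<in>S. card F \<le> n" "F \<in> S" "card F = n" "low_sphere n S"
    using ps_sphere_low_sphere[OF assms(1)] by blast
  have "asc_dim S = int (card F) - 1"
    using n ps_sphere_asc[OF assms(1)] by (intro asc_dim_eqI) (auto simp: asc_def)
  then show ?thesis using n assms(2) by simp
qed

text \<open>The largest faces are \<open>V \<union> H\<close> with \<open>H\<close> a largest face
  of \<open>S\<close>. As \<open>V\<close> is nonempty, only (1, 2), (2, 1) and (3, 0) remain for
  card V and n.\<close>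

lemma ps_ball_dim_2:
  assumes V: "finite V" "V \<noteq> {}" and S: "ps_sphere S" and dis: "V \<inter> \<Union>S = {}"
    and dim: "asc_dim (asc_join (Pow V) S) = 2"
  obtains n where "card V + n = 3" "low_sphere n S"
proof -
  obtain n H where n: "\<forall>F\<in>S. card F \<le> n" "H \<in> S" "card H = n" "low_sphere n S"
    using ps_sphere_low_sphere[OF S] by blast
  have finS: "finite S" "\<And>F. F \<in> S \<Longrightarrow> finite F"
    using ps_sphere_asc[OF S] by (auto simp: asc_def)
  have cU: "card (A \<union> B) = card A + card B" if "A \<subseteq> V" "B \<in> S" for A B
    using that finS(2)[OF that(2)] dis V finite_subset[OF that(1)] by (intro card_Un_disjoint) auto
  have "asc_join (Pow V) S = (\<Union>F\<in>Pow V. (\<lambda>G. F \<union> G) ` S)" by (rule asc_join_UN)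
  then have fin: "finite (asc_join (Pow V) S)" using V finS by simp
  have "asc_dim (asc_join (Pow V) S) = int (card (V \<union> H)) - 1"
  proof (rule asc_dim_eqI[OF fin])
    show "V \<union> H \<in> asc_join (Pow V) S" using n by (intro asc_joinI) simp_all
    fix G assume "G \<in> asc_join (Pow V) S"
    then obtain A B where G: "G = A \<union> B" "A \<in> Pow V" "B \<in> S" by (rule asc_joinE)
    then have "card A \<le> card V" "card B \<le> n" using n V card_mono[of V A] by auto
    then show "card G \<le> card (V \<union> H)"
      using G cU[of A B] cU[of V H] n(2,3) by simp
  qed
  then have "card V + n = 3" using dim cU[of V H] n by simp
  then show thesis using that n(4) by blast
qed

text \<open>Faces of the ear that miss a vertex of \<open>V\<close> lie in the boundary and hence in
  \<open>K\<close> already. The new ones are \<open>V \<union> G\<close> with \<open>G\<close> in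
  \<open>S\<close>, so the face numbers of \<open>S\<close> enter shifted by card V.\<close>

lemma face_count_ear:
  assumes V: "finite V" and S: "asc S" and dis: "V \<inter> \<Union>S = {}"
    and K: "finite K" "asc_join (Pow V) S \<inter> K = asc_join (simplex_bd V) S"
  shows "face_count (K \<union> asc_join (Pow V) S) k =
    face_count K k + (if card V \<le> k then face_count S (k - card V) else 0)"
proof -
  let ?int = "(\<lambda>G. V \<union> G) ` S"
  have finS: "finite S" "\<And>F. F \<in> S \<Longrightarrow> finite F" using S by (auto simp: asc_def)
  have "Pow V = simplex_bd V \<union> {V}" by (auto simp: simplex_bd_def)
  then have "asc_join (Pow V) S = asc_join (simplex_bd V) S \<union> ?int"
    by (simp add: asc_join_UN Un_commute)
  moreover have "?int \<inter> asc_join (simplex_bd V) S = {}"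
  proof -
    have "V \<union> G \<noteq> A \<union> B" if "G \<in> S" "A \<in> simplex_bd V" "B \<in> S" for G A B
      using that dis unfolding simplex_bd_def by blast
    then show ?thesis by (auto elim!: asc_joinE)
  qed
  ultimately have KB: "K \<union> asc_join (Pow V) S = K \<union> ?int" "K \<inter> ?int = {}"
    using K(2) by blast+
  have cU: "card (V \<union> G) = card V + card G" if "G \<in> S" for G
    using that finS(2)[OF that] dis V by (intro card_Un_disjoint) auto
  have "inj_on (\<lambda>G. V \<union> G) S"
  proof (rule inj_onI)
    fix G H assume "G \<in> S" "H \<in> S" "V \<union> G = V \<union> H"
    then show "G = H" using dis by blast
  qed
  then have inj: "card ((\<lambda>G. V \<union> G) ` A) = card A" if "A \<subseteq> S" for A
    using that by (meson card_image inj_on_subset)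
  have "{F \<in> ?int. card F = k} = (\<lambda>G. V \<union> G) ` {G \<in> S. card V + card G = k}"
    using cU by (intro equalityI subsetI; elim CollectE conjE imageE; simp)
  then have "card {F \<in> ?int. card F = k} = card {G \<in> S. card V + card G = k}" using inj by simp
  also have "{G \<in> S. card V + card G = k} =
      (if card V \<le> k then {G \<in> S. card G = k - card V} else {})" by auto
  also have "card \<dots> = (if card V \<le> k then face_count S (k - card V) else 0)"
    by (simp add: face_count_def)
  finally have "card {F \<in> ?int. card F = k} = (if card V \<le> k then face_count S (k - card V) else 0)" .
  moreover have "{F \<in> K \<union> ?int. card F = k} = {F \<in> K. card F = k} \<union> {F \<in> ?int. card F = k}" by blast
  moreover have "{F \<in> K. card F = k} \<inter> {F \<in> ?int. card F = k} = {}" using KB(2) by blast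
  ultimately show ?thesis using K(1) finS(1) by (simp add: face_count_def KB(1) card_Un_disjoint)
qed

text \<open>In terms of the \<open>h\<close>-vector, \<open>n - 4\<close> is \<open>h\<^sub>1 - 1\<close>, \<open>e - 3 * n + 6\<close> is \<open>h\<^sub>2 - h\<^sub>1\<close> and \<open>f - e + n - 1\<close> is
  \<open>h\<^sub>3\<close>. The last disjunct is there for the octahedron.\<close>

definition ear_counts :: "int \<Rightarrow> int \<Rightarrow> int \<Rightarrow> bool" where
  "ear_counts n e f \<longleftrightarrow> 4 \<le> n \<and> 0 \<le> e - 3 * n + 6 \<and> e - 3 * n + 7 \<le> f - e + n - 1 \<and>
     (n - 4 \<le> f - e + n - 1 \<or> f - e + n - 1 = n - 5 \<and> e - 3 * n + 6 \<le> n - 6)"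

text \<open>The edges are taken from the whole complex \<open>E\<close> and not from its part \<open>K\<close> built so far, so that ears
  without new vertices leave the graph condition untouched.\<close>

definition ear_inv :: "'a set set \<Rightarrow> 'a set set \<Rightarrow> bool" where
  "ear_inv E K \<longleftrightarrow> finite K \<and> rigid_like E (verts K) \<and>
     ear_counts (int (face_count K 1)) (int (face_count K 2)) (int (face_count K 3))"

text \<open>Each of the three spheres has excess 0 and h_3 = 1, while n - 4 is 0, 1 or 2; only the
  octahedron needs the last disjunct of \<open>ear_counts\<close>.\<close>

lemma ear_inv_sphere:
  assumes "ps_sphere S" "asc_dim S = 2" "S \<subseteq> E"
  shows "ear_inv E S"
proof -
  have S: "low_sphere 3 S" using assms(1,2) by (rule ps_sphere_dim_2)
  then show ?thesis
    using low_sphere_3_counts[OF S] low_sphere_3_rigid_like[OF S assms(3)] ps_sphere_asc[OF assms(1)]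
    by (auto simp: ear_inv_def ear_counts_def asc_def)
qed

text \<open>Every ear raises h_3 by 1 and the excess by at most 1. A cone also adds a vertex and
  thus preserves either disjunct of \<open>ear_counts\<close>; an ear without new vertices preserves
  the first and turns the second into the first. In the graph, the apex of a cone is a new vertex
  with three or four earlier neighbours.\<close>

lemma ear_inv_ball:
  assumes K: "ear_inv E K" and B: "ps_ball B" "asc_dim B = 2" "B \<inter> K = ball_bd B" "B \<subseteq> E"
  shows "ear_inv E (K \<union> B)"
proof -
  obtain V S where V: "finite V" "V \<noteq> {}" and S: "ps_sphere S" and dis: "V \<inter> \<Union>S = {}"
    and B_eq: "B = asc_join (Pow V) S"
    using B(1) by (auto simp: ps_ball_def)
  obtain n where n: "card V + n = 3" "low_sphere n S"
    using ps_ball_dim_2[OF V S dis] B(2) B_eq by metis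
  have finK: "finite K" and rig: "rigid_like E (verts K)"
    and cnt: "ear_counts (int (face_count K 1)) (int (face_count K 2)) (int (face_count K 3))"
    using K by (auto simp: ear_inv_def)
  have ascS: "asc S" and S0: "{} \<in> S" using ps_sphere_asc[OF S] by (auto simp: asc_def)
  have bd: "asc_join (Pow V) S \<inter> K = asc_join (simplex_bd V) S"
    using B(3) ball_bd_ps_ball[OF V S dis] B_eq by simp
  have fc: "face_count (K \<union> B) k = face_count K k + (if card V \<le> k then face_count S (k - card V) else 0)" for k
    unfolding B_eq by (rule face_count_ear[OF V(1) ascS dis finK bd])
  have fcS0: "face_count S 0 = 1" using ascS by (rule asc_face_count_0)
  have "finite B" unfolding B_eq asc_join_UN using V ascS by (simp add: asc_def)
  then have fin: "finite (K \<union> B)" using finK by simp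
  have vB: "verts B = V \<union> verts S"
    unfolding B_eq using S0 by (subst verts_asc_join) (auto simp: verts_def)
  have vbd: "verts (simplex_bd V) \<union> verts S \<subseteq> verts K"
    using bd verts_asc_join[OF empty_in_simplex_bd[OF V(2)] S0] by (auto simp: verts_def)
  have vU: "verts (K \<union> B) = verts K \<union> verts B" by (auto simp: verts_def)
  consider "card V = 1" "n = 2" | "card V = 2" "n = 1" | "card V = 3" "n = 0"
  proof -
    have "0 < card V" using V by (simp add: card_gt_0_iff)
    then show thesis using n(1) that by linarith
  qed
  then show ?thesis
  proof cases
    case 1
    then obtain v where v: "V = {v}" by (auto simp: card_1_singleton_iff)
    have S2: "face_count S 2 = face_count S 1 \<and> (face_count S 1 = 3 \<or> face_count S 1 = 4)"
      using n(2) 1 low_sphere_2_counts by simp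
    have "simplex_bd V = {{}}" by (auto simp: simplex_bd_def v)
    then have bdS: "asc_join (Pow V) S \<inter> K = S" using bd by (simp add: asc_join_unit)
    \<comment> \<open>Otherwise {v} would be a face of the ear in \<open>K\<close>, hence of
      \<open>S\<close>, which is disjoint from \<open>V\<close>.\<close>
    have "v \<notin> verts K"
    proof
      assume "v \<in> verts K"
      moreover have "{v} \<in> asc_join (Pow V) S" using S0 asc_joinI[of V "Pow V" "{}" S] v by simp
      ultimately have "{v} \<in> S" using bdS by (auto simp: verts_def)
      then show False using dis v by auto
    qed
    moreover have "verts S \<subseteq> verts K" using vbd by simp
    moreover have "3 \<le> card (verts S)" using S2 by (auto simp flip: face_count_1)
    moreover have "{u, v} \<in> E" if "u \<in> verts S" for u
    proof -
      have "{v} \<union> {u} \<in> B" unfolding B_eq v by (rule asc_joinI) (use that in \<open>auto simp: verts_def\<close>)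
      then show ?thesis using B(4) by (auto simp: insert_commute)
    qed
    ultimately have "rigid_like E (insert v (verts K))" by (rule rigid_like_insert_subset[OF rig])
    moreover have "verts (K \<union> B) = insert v (verts K)" using vU vB vbd v by auto
    moreover have "ear_counts (int (face_count (K \<union> B) 1)) (int (face_count (K \<union> B) 2)) (int (face_count (K \<union> B) 3))"
      using cnt S2 fcS0 1 by (auto simp: fc ear_counts_def)
    ultimately show ?thesis using fin by (simp add: ear_inv_def)
  next
    case 2
    then have "is_simplex_bd (Suc (Suc 0)) S" using n(2) by (simp add: low_sphere_def numeral_2_eq_2)
    then have "face_count S 1 = 2" using is_simplex_bd_counts(3)[of 0 S 1] by simp
    then have "ear_counts (int (face_count (K \<union> B) 1)) (int (face_count (K \<union> B) 2)) (int (face_count (K \<union> B) 3))"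
      using cnt fcS0 2 by (auto simp: fc ear_counts_def)
    \<comment> \<open>With at least two elements in \<open>V\<close>, all its vertices lie on the
      boundary, which is part of \<open>K\<close>.\<close>
    moreover have "verts (K \<union> B) = verts K" using vU vB vbd verts_simplex_bd[of V] 2 by auto
    ultimately show ?thesis using fin rig by (simp add: ear_inv_def)
  next
    case 3
    then have "ear_counts (int (face_count (K \<union> B) 1)) (int (face_count (K \<union> B) 2)) (int (face_count (K \<union> B) 3))"
      using cnt fcS0 by (auto simp: fc ear_counts_def)
    moreover have "verts (K \<union> B) = verts K" using vU vB vbd verts_simplex_bd[of V] 3 by auto
    ultimately show ?thesis using fin rig by (simp add: ear_inv_def)
  qed
qed

text \<open>The first argument of \<open>ear_inv\<close> stays the final complex, while the second
  runs through the partial unions of ears.\<close>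

lemma ear_inv_ps_ear_decomposition:
  assumes dec: "ps_ear_decomposition K t \<Sigma>"
  shows "ear_inv K K"
proof -
  have sub: "\<Sigma> j \<subseteq> K" if "j \<le> t" for j using dec that by (auto simp: ps_ear_decomposition_def)
  have "ear_inv K (\<Union>i\<le>j. \<Sigma> i)" if "j \<le> t" for j
    using that
  proof (induction j)
    case 0
    have "ps_sphere (\<Sigma> 0)" "asc_dim (\<Sigma> 0) = 2" using dec by (auto simp: ps_ear_decomposition_def)
    then have "ear_inv K (\<Sigma> 0)" using sub[of 0] by (intro ear_inv_sphere) auto
    then show ?case by simp
  next
    case (Suc j)
    have "(\<Union>i\<le>Suc j. \<Sigma> i) = (\<Union>i\<le>j. \<Sigma> i) \<union> \<Sigma> (Suc j)" by (auto simp: atMost_Suc)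
    moreover have "Suc j \<in> {1..t}" using Suc.prems by simp
    then have "\<Sigma> (Suc j) \<inter> (\<Union>i<Suc j. \<Sigma> i) = ball_bd (\<Sigma> (Suc j))"
      using dec unfolding ps_ear_decomposition_def by blast
    then have "\<Sigma> (Suc j) \<inter> (\<Union>i\<le>j. \<Sigma> i) = ball_bd (\<Sigma> (Suc j))"
      by (simp only: lessThan_Suc_atMost)
    moreover have "ps_ball (\<Sigma> (Suc j))" "asc_dim (\<Sigma> (Suc j)) = 2"
      using dec Suc.prems by (auto simp: ps_ear_decomposition_def)
    ultimately show ?case using ear_inv_ball[OF _ _ _ _ sub[OF Suc.prems]] Suc by simp
  qed
  then show ?thesis using dec by (simp add: ps_ear_decomposition_def)
qed

section \<open>From face numbers to the h-vector\<close>

lemma f_num_face_count: "f_num K (int k) = face_count K (Suc k)"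
proof -
  have "face_dim F = int k \<longleftrightarrow> card F = Suc k" for F :: "'a set"
    by (auto simp: face_dim_def)
  then show ?thesis by (simp add: f_num_def face_count_def)
qed

theorem theorem1p11:
  fixes \<Delta> :: "'a set set"
  assumes "asc \<Delta>"
    and "asc_dim \<Delta> = 2"
    and "ps_ear_decomposable \<Delta>"
  shows "pure_O_sequence (h_vector2 \<Delta>)"
proof -
  obtain t \<Sigma> where "ps_ear_decomposition \<Delta> t \<Sigma>"
    using assms(3) by (auto simp: ps_ear_decomposable_def)
  then have inv: "ear_inv \<Delta> \<Delta>" by (rule ear_inv_ps_ear_decomposition)
  define n where "n = face_count \<Delta> 1"
  define e where "e = face_count \<Delta> 2"
  define f where "f = face_count \<Delta> 3"
  let ?W = "verts \<Delta>"
  have sub: "F \<subseteq> ?W" if "F \<in> \<Delta>" for F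
    using assms(1) that by (auto simp: asc_def verts_def)
  have cW: "card ?W = n" by (simp add: n_def face_count_1 del: One_nat_def)
  have rig: "rigid_like \<Delta> ?W" and cnt: "ear_counts (int n) (int e) (int f)"
    using inv by (simp_all add: ear_inv_def n_def e_def f_def)
  have finW: "finite ?W" using rig by (simp add: rigid_like_def)
  have "{F \<in> \<Delta>. card F = 2 \<and> F \<subseteq> ?W} = {F \<in> \<Delta>. card F = 2}" using sub by blast
  then have ecount: "edge_count \<Delta> ?W = e" by (simp add: edge_count_def e_def face_count_def)
  have ex: "excess \<Delta> ?W = int e - 3 * int n + 6" by (simp add: excess_def ecount cW)
  \<comment> \<open>All edges of a 2-face belong to the complex, so each 2-face is a triangle of the
    graph.\<close>
  have f_le: "f \<le> triangle_count \<Delta> ?W"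
    unfolding f_def face_count_def triangle_count_def
    using finW sub assms(1) by (intro card_mono) (auto simp: asc_def)
  \<comment> \<open>Here N = h_1 - 1 is the number of variables apart from the cone
    variable.\<close>
  obtain N where N: "n = N + 4" using cnt by (metis add.commute ear_counts_def le_Suc_ex of_nat_le_iff of_nat_numeral)
  obtain q where q: "int e - 3 * int n + 6 = int q" using cnt by (metis ear_counts_def zero_le_imp_eq_int)
  obtain h where h: "int f - int e + int n - 1 = int h"
    using cnt zero_le_imp_eq_int[of "int f - int e + int n - 1"] by (auto simp: ear_counts_def)
  have e: "e = q + 3 * N + 6" using q N by simp
  have "int f \<le> 3 * int n - 8 + 2 * int q + int (phi q)"
    using rig f_le cW by (simp add: rigid_like_def ex q)
  then have h_le: "h \<le> Suc N + q + phi q" using h N e by simp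
  have "e \<le> (n choose 2)" using edge_count_le[OF finW, of \<Delta>] ecount cW by simp
  \<comment> \<open>Subtracting 3 N + 6 from C(N + 4, 2) leaves C(N + 1, 2), the number of quadratic
    monomials in N variables.\<close>
  then have q_le: "q \<le> (Suc N choose 2)"
    by (simp add: N e choose_2_Suc[of "Suc N"] choose_2_Suc[of "Suc (Suc N)"]
        choose_2_Suc[of "Suc (Suc (Suc N))"] eval_nat_numeral(2,3))
  have cnt': "q < h" "N \<le> h \<or> Suc h = N \<and> q + 2 \<le> N"
    using cnt N e h by (auto simp: ear_counts_def)
  have hv: "h_vector2 \<Delta> = [1, int (Suc N), int (Suc N + q), int h]"
  proof -
    have "f_num \<Delta> 0 = n" "f_num \<Delta> 1 = e" "f_num \<Delta> 2 = f"
      using f_num_face_count[of \<Delta> 0] f_num_face_count[of \<Delta> 1] f_num_face_count[of \<Delta> 2]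
      by (simp_all add: n_def e_def f_def eval_nat_numeral)
    then show ?thesis using h N e by (simp add: h_vector2_def)
  qed
  consider "Suc N + q \<le> h" | "N \<le> h" "h \<le> Suc N + q" | "Suc h = N" "q + 2 \<le> N"
    using cnt'(2) by linarith
  then show ?thesis
  proof cases
    case 1
    then show ?thesis unfolding hv using q_le h_le by (intro pure_O_sequence_large)
  next
    case 2
    then show ?thesis unfolding hv using q_le cnt'(1) by (intro pure_O_sequence_small)
  next
    case 3
    \<comment> \<open>The octahedron has N = 2 and excess 0, and only cones over 4-cycles raise the
      excess: there are q of these and N - 2 - q cones over triangle boundaries.\<close>
    then have "3 + (N - 2 - q) + q = Suc N" "3 + (N - 2 - q) + 2 * q = Suc N + q" "1 + (N - 2 - q) + q = h"
      by simp_all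
    then show ?thesis unfolding hv using pure_O_sequence_octahedral[of "N - 2 - q" q] by metis
  qed
qed

end
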